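(* Let $K$ be a field and let $E$ be a finite directed graph. If $E$ has a sink, then the Leavitt path algebra $L_K(E)$ (with its standard $\mathbb{Z}$-grading) has gr-IBN.
   Context: A directed graph $E=(E^0,E^1,s,r)$ consists of disjoint sets $E^0$ (vertices) and $E^1$ (edges) with maps $s,r:E^1\to E^0$ (source, range). It is finite if $E^0$ and $E^1$ are finite. A sink is a vertex $v$ with $s^{-1}(v)=\emptyset$; a vertex $v$ is regular if $0<|s^{-1}(v)|<\infty$. The Leavitt path algebra $L_K(E)$ is the $K$-algebra generated by $E^0\cup E^1\cup\{e^*\mid e\in E^1\}$ subject to, for all $v,w\in E^0$ and $e,f\in E^1$: (1) $vw=\delta_{v,w}w$; (2) $s(e)e=e=er(e)$ and $r(e)e^*=e^*=e^*s(e)$; (3) $e^*f=\delta_{e,f}r(e)$; (4) $v=\sum_{e\in s^{-1}(v)}ee^*$ for every regular vertex $v$. It is $\mathbb{Z}$-graded with $\deg v=0$, $\deg e=1$, $\deg e^*=-1$. For an abelian group $\Gamma$, a $\Gamma$-graded ring $R$ and $\delta\in\Gamma$, the shifted graded right module $R(\delta)$ has components $R(\delta)_\gamma=R_{\delta+\gamma}$; $\cong_{gr}$ denotes isomorphism of right modules preserving degrees. $R$ has gr-IBN (Graded Invariant Basis Number) if for all positive integers $m,n$ and all $\alpha_1,\dots,\alpha_m,\beta_1,\dots,\beta_n\in\Gamma$, $R(\alpha_1)\oplus\cdots\oplus R(\alpha_m)\cong_{gr}R(\beta_1)\oplus\cdots\oplus R(\beta_n)$ as graded right $R$-modules implies $m=n$.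 *)

theory Defs
  imports
    "HOL-Algebra.QuotRing"
    "HOL-Library.FuncSet"
    "HOL-Library.Poly_Mapping"
    "Graph_Theory.Digraph"
begin

section \<open>Graded rings, graded right modules, gr-IBN\<close>

text \<open>
  A grading is a family of additive subgroups such that every element of the ring is in exactly
  one way a finite sum of homogeneous components (internal direct sum).
\<close>

locale graded_ring = ring R for R (structure) +
  fixes grade :: "'g::ab_group_add \<Rightarrow> 'a set"
  assumes grade_subgroup: "additive_subgroup (grade \<gamma>) R"
    and grade_mult: "\<lbrakk>x \<in> grade \<gamma>; y \<in> grade \<delta>\<rbrakk> \<Longrightarrow> x \<otimes> y \<in> grade (\<gamma> + \<delta>)"
    and grade_decomp: "x \<in> carrier R \<Longrightarrow>
      \<exists>!c. (\<forall>\<gamma>. c \<gamma> \<in> grade \<gamma>) \<and> finite {\<gamma>. c \<gamma> \<noteq> \<zero>} \<and>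
           x = (\<Oplus>\<gamma>\<in>{\<gamma>. c \<gamma> \<noteq> \<zero>}. c \<gamma>)"

record ('x, 'r, 'g) graded_rmodule = "'x partial_object" +
  madd :: "'x \<Rightarrow> 'x \<Rightarrow> 'x"
  ract :: "'x \<Rightarrow> 'r \<Rightarrow> 'x"
  component :: "'g \<Rightarrow> 'x set"

definition shifted_regular ::
    "('a, 'm) ring_scheme \<Rightarrow> ('g::ab_group_add \<Rightarrow> 'a set) \<Rightarrow> 'g \<Rightarrow> ('a, 'a, 'g) graded_rmodule"
  where "shifted_regular R grade \<delta> =
    \<lparr>carrier = carrier R, madd = add R, ract = mult R, component = (\<lambda>\<gamma>. grade (\<delta> + \<gamma>))\<rparr>"

text \<open>The external direct sum of \<open>M 0, \<dots>, M (n - 1)\<close>; elements are extensional functions.\<close>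

definition direct_sum ::
    "nat \<Rightarrow> (nat \<Rightarrow> ('x, 'r, 'g) graded_rmodule) \<Rightarrow> (nat \<Rightarrow> 'x, 'r, 'g) graded_rmodule"
  where "direct_sum n M =
    \<lparr>carrier = (\<Pi>\<^sub>E i\<in>{..<n}. carrier (M i)),
     madd = (\<lambda>x y. \<lambda>i\<in>{..<n}. madd (M i) (x i) (y i)),
     ract = (\<lambda>x r. \<lambda>i\<in>{..<n}. ract (M i) (x i) r),
     component = (\<lambda>\<gamma>. \<Pi>\<^sub>E i\<in>{..<n}. component (M i) \<gamma>)\<rparr>"

definition graded_iso ::
    "('r, 'm) ring_scheme \<Rightarrow> ('x, 'r, 'g) graded_rmodule \<Rightarrow> ('y, 'r, 'g) graded_rmodule \<Rightarrow> bool"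
  where "graded_iso R M N \<longleftrightarrow>
    (\<exists>f. bij_betw f (carrier M) (carrier N) \<and>
         (\<forall>x\<in>carrier M. \<forall>y\<in>carrier M. f (madd M x y) = madd N (f x) (f y)) \<and>
         (\<forall>x\<in>carrier M. \<forall>r\<in>carrier R. f (ract M x r) = ract N (f x) r) \<and>
         (\<forall>\<gamma>. f ` component M \<gamma> \<subseteq> component N \<gamma>))"

definition gr_IBN :: "('a, 'm) ring_scheme \<Rightarrow> ('g::ab_group_add \<Rightarrow> 'a set) \<Rightarrow> bool"
  where "gr_IBN R grade \<longleftrightarrow>
    graded_ring R grade \<and>
    (\<forall>m n (\<alpha> :: nat \<Rightarrow> 'g) (\<beta> :: nat \<Rightarrow> 'g). 0 < m \<longrightarrow> 0 < n \<longrightarrow>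
       graded_iso R (direct_sum m (\<lambda>i. shifted_regular R grade (\<alpha> i)))
                    (direct_sum n (\<lambda>j. shifted_regular R grade (\<beta> j))) \<longrightarrow>
       m = n)"


section \<open>The free algebra on vertices, edges and ghost edges\<close>

datatype ('v, 'e) letter = Vertex 'v | Edge 'e | Ghost 'e

text \<open>
  The free monoid, written additively because convolution on \<^type>\<open>poly_mapping\<close>
  expects an additive (not necessarily commutative) index monoid.
\<close>

datatype ('v, 'e) word = Word (letters: "('v, 'e) letter list")

instantiation word :: (type, type) monoid_add
begin

definition "0 = Word []"

definition "u + v = Word (letters u @ letters v)"

instance
  by standard (simp_all add: zero_word_def plus_word_def)

end

type_synonym ('v, 'e, 'k) path_poly = "('v, 'e) word \<Rightarrow>\<^sub>0 'k"

definition graph_letters :: "('v, 'e) pre_digraph \<Rightarrow> ('v, 'e) letter set"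
  where "graph_letters G = Vertex ` verts G \<union> Edge ` arcs G \<union> Ghost ` arcs G"

definition free_algebra :: "('v, 'e) pre_digraph \<Rightarrow> ('v, 'e, 'k::field) path_poly ring"
  where "free_algebra G =
    \<lparr>carrier = {p. \<forall>w\<in>Poly_Mapping.keys p. set (letters w) \<subseteq> graph_letters G},
     mult = (*), one = 1, zero = 0, add = (+)\<rparr>"

lemma ring_free_algebra: "ring (free_algebra G)"
proof (rule ringI)
  let ?A = "free_algebra G :: ('a, 'b, 'c::field) path_poly ring"
  have neg: "- x \<in> carrier ?A" if "x \<in> carrier ?A" for x
    using that by (simp add: free_algebra_def)
  show "abelian_group ?A"
  proof (rule abelian_groupI)
    show "x \<oplus>\<^bsub>?A\<^esub> y \<in> carrier ?A" if "x \<in> carrier ?A" "y \<in> carrier ?A" for x y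
      using that Poly_Mapping.keys_add[of x y] by (auto simp: free_algebra_def)
    show "\<exists>y\<in>carrier ?A. y \<oplus>\<^bsub>?A\<^esub> x = \<zero>\<^bsub>?A\<^esub>" if "x \<in> carrier ?A" for x
      using neg[OF that] by (intro bexI[of _ "- x"]) (simp_all add: free_algebra_def)
  qed (simp_all add: free_algebra_def add_ac)
  show "monoid ?A"
  proof (rule monoidI)
    show "x \<otimes>\<^bsub>?A\<^esub> y \<in> carrier ?A" if "x \<in> carrier ?A" "y \<in> carrier ?A" for x y
      using that Poly_Mapping.keys_mult[of x y]
      by (fastforce simp: free_algebra_def plus_word_def)
    show "\<one>\<^bsub>?A\<^esub> \<in> carrier ?A"
      by (simp add: free_algebra_def zero_word_def)
  qed (simp_all add: free_algebra_def mult.assoc)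
qed (simp_all add: free_algebra_def distrib_left distrib_right)

abbreviation vtx :: "'v \<Rightarrow> ('v, 'e, 'k::field) path_poly"
  where "vtx v \<equiv> Poly_Mapping.single (Word [Vertex v]) 1"

abbreviation edge :: "'e \<Rightarrow> ('v, 'e, 'k::field) path_poly"
  where "edge e \<equiv> Poly_Mapping.single (Word [Edge e]) 1"

abbreviation ghost :: "'e \<Rightarrow> ('v, 'e, 'k::field) path_poly"
  where "ghost e \<equiv> Poly_Mapping.single (Word [Ghost e]) 1"


section \<open>Leavitt path algebras\<close>

text \<open>
  In the digraph library the source of an edge is its \<^const>\<open>tail\<close>
  and the range is its \<^const>\<open>head\<close>.
\<close>

definition sink :: "('v, 'e) pre_digraph \<Rightarrow> 'v \<Rightarrow> bool"
  where "sink G v \<longleftrightarrow> v \<in> verts G \<and> out_arcs G v = {}"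

definition regular :: "('v, 'e) pre_digraph \<Rightarrow> 'v \<Rightarrow> bool"
  where "regular G v \<longleftrightarrow> v \<in> verts G \<and> out_arcs G v \<noteq> {} \<and> finite (out_arcs G v)"

text \<open>Each relation \<open>l = r\<close> is recorded as the element \<open>l - r\<close>.\<close>

definition leavitt_relations :: "('v, 'e) pre_digraph \<Rightarrow> ('v, 'e, 'k::field) path_poly set"
  where "leavitt_relations G =
    {vtx v * vtx w - (if v = w then vtx w else 0) | v w. v \<in> verts G \<and> w \<in> verts G} \<union>
    {vtx (tail G e) * edge e - edge e | e. e \<in> arcs G} \<union>
    {edge e * vtx (head G e) - edge e | e. e \<in> arcs G} \<union>
    {vtx (head G e) * ghost e - ghost e | e. e \<in> arcs G} \<union>
    {ghost e * vtx (tail G e) - ghost e | e. e \<in> arcs G} \<union>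
    {ghost e * edge f - (if e = f then vtx (head G e) else 0) | e f. e \<in> arcs G \<and> f \<in> arcs G} \<union>
    {vtx v - (\<Sum>e\<in>out_arcs G v. edge e * ghost e) | v. regular G v}"

definition leavitt_ideal :: "('v, 'e) pre_digraph \<Rightarrow> ('v, 'e, 'k::field) path_poly set"
  where "leavitt_ideal G = Idl\<^bsub>free_algebra G\<^esub> (leavitt_relations G)"

abbreviation leavitt_class ::
    "('v, 'e) pre_digraph \<Rightarrow> ('v, 'e, 'k::field) path_poly \<Rightarrow> ('v, 'e, 'k) path_poly set"
  where "leavitt_class G p \<equiv> leavitt_ideal G +>\<^bsub>free_algebra G\<^esub> p"

text \<open>
  The presentation is one of algebras that need not be unital, so only polynomials without
  constant term (no empty word) are used. They contain the relations, and a subset of them is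
  an algebra ideal of the free non-unital algebra iff it is an ideal of
  \<^const>\<open>free_algebra\<close>. Hence the Leavitt path algebra is their image in the
  quotient ring. For finitely many vertices its identity is the class of the sum of all vertices
  (whereas the class of the empty word lies outside of it).
\<close>

definition nonunital_part :: "('v, 'e) pre_digraph \<Rightarrow> ('v, 'e, 'k::field) path_poly set"
  where "nonunital_part G = {p \<in> carrier (free_algebra G). 0 \<notin> Poly_Mapping.keys p}"

definition leavitt_path_algebra ::
    "('v, 'e) pre_digraph \<Rightarrow> ('v, 'e, 'k::field) path_poly set ring"
  where "leavitt_path_algebra G =
    (free_algebra G Quot leavitt_ideal G)
      \<lparr>carrier := leavitt_class G ` nonunital_part G,
       one := leavitt_class G (\<Sum>v\<in>verts G. vtx v)\<rparr>"

fun letter_degree :: "('v, 'e) letter \<Rightarrow> int"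
  where
    "letter_degree (Vertex v) = 0"
  | "letter_degree (Edge e) = 1"
  | "letter_degree (Ghost e) = - 1"

definition word_degree :: "('v, 'e) word \<Rightarrow> int"
  where "word_degree w = sum_list (map letter_degree (letters w))"

definition leavitt_grading ::
    "('v, 'e) pre_digraph \<Rightarrow> int \<Rightarrow> ('v, 'e, 'k::field) path_poly set set"
  where "leavitt_grading G n =
    leavitt_class G ` {p \<in> nonunital_part G. \<forall>w\<in>Poly_Mapping.keys p. word_degree w = n}"

end

theory Submission
  imports Defs "HOL-Library.Multiset"
begin

text \<open>
  Let \<open>s\<close> be a sink and \<open>R\<close> the Leavitt path algebra. The idea is to compare, degree by degree,
  the dimensions of the left ideal \<open>R s\<close>.

  A graded isomorphism \<open>f\<close> from \<open>R(\<alpha>\<^sub>1) \<oplus> \<dots> \<oplus> R(\<alpha>\<^sub>m)\<close> to \<open>R(\<beta>\<^sub>1) \<oplus> \<dots> \<oplus> R(\<beta>\<^sub>n)\<close> is linear for the right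
  action of \<open>R\<close>. Hence it commutes with right multiplication by the elements \<open>c s\<close> for scalars \<open>c\<close>,
  and restricts to an isomorphism of graded \<open>K\<close>-vector spaces from \<open>R(\<alpha>\<^sub>1)s \<oplus> \<dots> \<oplus> R(\<alpha>\<^sub>m)s\<close> to
  \<open>R(\<beta>\<^sub>1)s \<oplus> \<dots> \<oplus> R(\<beta>\<^sub>n)s\<close>. If \<open>a d\<close> denotes the dimension of \<open>R\<^sub>d s\<close> and is finite, it follows that
  \<open>a (\<alpha>\<^sub>1 + \<gamma>) + \<dots> + a (\<alpha>\<^sub>m + \<gamma>) = a (\<beta>\<^sub>1 + \<gamma>) + \<dots> + a (\<beta>\<^sub>n + \<gamma>)\<close> for every degree \<open>\<gamma>\<close>. This is the
  content of the locale \<open>graded_ring_with_coordinates\<close>, where a basis of each \<open>R\<^sub>d s\<close> and the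
  coordinates with respect to it are given.

  The paths of length \<open>d\<close> that end at \<open>s\<close> form a basis of \<open>R\<^sub>d s\<close>. They span because no edge
  leaves \<open>s\<close>: a word in the generators, multiplied by \<open>s\<close> on the right, is rewritten letter by letter
  by the relations either to \<open>0\<close> or to such a path (\<open>word_mult_sink\<close>, \<open>homogeneous_mult_sink\<close>); a
  ghost edge that reaches \<open>s\<close> vanishes. They are independent because \<open>R\<close> acts on the
  \<open>K\<close>-valued functions on these paths in such a way that a path maps the indicator function of the
  trivial path to its own indicator function (\<open>leavitt_ideal_acts_trivially\<close>,
  \<open>path_monomial_action\<close>). The relation at regular vertices holds in it because the trivial path
  starts at \<open>s\<close>, which is not a regular vertex.

  So \<open>a d\<close> is finite, as there are finitely many edges; it vanishes for \<open>d < 0\<close>, and \<open>a 0 > 0\<close>.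
  Comparing the extreme shifts shows that such a function determines the multiset of
  the shifts (\<open>multiset_eq_if_shifted_sums_eq\<close>). In particular \<open>m = n\<close>.

  That \<open>R\<close> is a graded ring with identity the sum of the vertices rests on the homogeneity of the
  defining relations: the ideal that they generate contains the homogeneous components of its
  elements (\<open>leavitt_ideal_homogeneous_part\<close>), so the components of an element of \<open>R\<close> are well
  defined.
\<close>

section \<open>Linear systems and sums of shifted functions\<close>

text \<open>
  Gaussian elimination: an equation with a nonzero coefficient at \<open>s0\<close> is used to remove the unknown
  \<open>s0\<close> from the other equations.
\<close>

lemma underdetermined_system_has_nontrivial_solution:
  fixes M :: "'t \<Rightarrow> 's \<Rightarrow> 'k::field"
  assumes "finite T" "finite S" "card T < card S"
  shows "\<exists>c. (\<exists>s\<in>S. c s \<noteq> 0) \<and> (\<forall>t\<in>T. (\<Sum>s\<in>S. M t s * c s) = 0)"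
  using assms
proof (induction T arbitrary: S M rule: finite_induct)
  case empty
  then obtain s where "s \<in> S" by fastforce
  then show ?case by (intro exI[of _ "\<lambda>_. 1"]) auto
next
  case (insert t T)
  show ?case
  proof (cases "\<forall>s\<in>S. M t s = 0")
    case True
    have "card T < card S" using insert.prems insert.hyps by simp
    from insert.IH[OF insert.prems(1) this, of M] obtain c
      where "\<exists>s\<in>S. c s \<noteq> 0" "\<forall>t\<in>T. (\<Sum>s\<in>S. M t s * c s) = 0" by blast
    then show ?thesis using True by (intro exI[of _ c]) auto
  next
    case False
    then obtain s0 where s0: "s0 \<in> S" "M t s0 \<noteq> 0" by blast
    define S' where "S' = S - {s0}"
    have S: "S = insert s0 S'" "s0 \<notin> S'" "finite S'" using s0 insert.prems by (auto simp: S'_def)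
    have "card T < card S'" using insert.prems insert.hyps S by simp
    \<comment> \<open>The remaining equations after substituting for \<open>s0\<close> the solution of equation \<open>t\<close>.\<close>
    from insert.IH[OF S(3) this, of "\<lambda>t' s. M t' s - M t' s0 * M t s / M t s0"] obtain c
      where c: "\<exists>s\<in>S'. c s \<noteq> 0"
        and sol: "\<forall>t'\<in>T. (\<Sum>s\<in>S'. (M t' s - M t' s0 * M t s / M t s0) * c s) = 0" by blast
    define c' where "c' = c(s0 := - (\<Sum>s\<in>S'. M t s * c s) / M t s0)"
    have eq: "(\<Sum>s\<in>S. M t' s * c' s) =
        (\<Sum>s\<in>S'. M t' s * c s) - M t' s0 * (\<Sum>s\<in>S'. M t s * c s) / M t s0" for t'
    proof -
      have "(\<Sum>s\<in>S'. M t' s * c' s) = (\<Sum>s\<in>S'. M t' s * c s)"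
        using S(2) by (intro sum.cong) (auto simp: c'_def)
      then show ?thesis using S by (simp add: c'_def)
    qed
    have "(\<Sum>s\<in>S. M t' s * c' s) = 0" if "t' \<in> T" for t'
    proof -
      have "(\<Sum>s\<in>S'. (M t' s - M t' s0 * M t s / M t s0) * c s) =
          (\<Sum>s\<in>S'. M t' s * c s) - M t' s0 * (\<Sum>s\<in>S'. M t s * c s) / M t s0"
        by (simp add: left_diff_distrib sum_subtractf sum_distrib_left sum_divide_distrib mult.assoc)
      then show ?thesis using sol that eq by simp
    qed
    moreover have "(\<Sum>s\<in>S. M t s * c' s) = 0" using s0 by (simp add: eq)
    moreover have "\<exists>s\<in>S. c' s \<noteq> 0" using c S by (auto simp: c'_def)
    ultimately show ?thesis by (intro exI[of _ c']) auto
  qed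
qed

text \<open>
  Cancelling common elements leaves two disjoint multisets. If \<open>m\<close> is the largest element that
  occurs in them, then shifting by \<open>- m\<close> gives a positive sum on the side that contains \<open>m\<close> and, since
  only negative arguments occur there, zero on the other side.
\<close>

lemma multiset_eq_if_shifted_sums_eq:
  fixes a :: "'g::linordered_ab_group_add \<Rightarrow> nat"
  assumes neg: "\<And>d. d < 0 \<Longrightarrow> a d = 0" and pos: "a 0 > 0"
    and eq: "\<And>\<gamma>. (\<Sum>x\<in>#A. a (x + \<gamma>)) = (\<Sum>x\<in>#B. a (x + \<gamma>))"
  shows "A = B"
proof (rule ccontr)
  assume "A \<noteq> B"
  define A' B' where "A' = A - B" and "B' = B - A"
  have split: "A = A \<inter># B + A'" "B = A \<inter># B + B'"
    by (auto simp: A'_def B'_def multiset_eq_iff)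
  have eq': "(\<Sum>x\<in>#A'. a (x + \<gamma>)) = (\<Sum>x\<in>#B'. a (x + \<gamma>))" for \<gamma>
  proof -
    have "(\<Sum>x\<in>#A. a (x + \<gamma>)) = (\<Sum>x\<in>#A \<inter># B. a (x + \<gamma>)) + (\<Sum>x\<in>#A'. a (x + \<gamma>))"
      by (subst split(1)) simp
    moreover have "(\<Sum>x\<in>#B. a (x + \<gamma>)) = (\<Sum>x\<in>#A \<inter># B. a (x + \<gamma>)) + (\<Sum>x\<in>#B'. a (x + \<gamma>))"
      by (subst split(2)) simp
    ultimately show ?thesis using eq[of \<gamma>] by simp
  qed
  define m where "m = Max (set_mset A' \<union> set_mset B')"
  have ne: "set_mset A' \<union> set_mset B' \<noteq> {}"
    using \<open>A \<noteq> B\<close> split by (metis Un_empty set_mset_eq_empty_iff)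
  have m: "m \<in># A' \<or> m \<in># B'" and le: "\<And>x. x \<in># A' \<or> x \<in># B' \<Longrightarrow> x \<le> m"
    using Max_in[OF _ ne] Max_ge[of "set_mset A' \<union> set_mset B'"] by (auto simp: m_def)
  have disj: "\<not> (x \<in># A' \<and> x \<in># B')" for x
    by (auto simp: A'_def B'_def in_diff_count)
  \<comment> \<open>At the shift \<open>- m\<close> only copies of \<open>m\<close> itself contribute.\<close>
  have zero: "(\<Sum>x\<in>#C. a (x + (- m))) = 0" if "\<And>x. x \<in># C \<Longrightarrow> x \<le> m \<and> x \<noteq> m" for C
    using that by (induction C) (auto intro!: neg simp: less_le)
  have positive: "(\<Sum>x\<in>#C. a (x + (- m))) > 0" if "m \<in># C" for C
    using pos by (subst insert_DiffM[OF that, symmetric]) simp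
  have absurd: False if "m \<in># C" "\<And>x. x \<in># D \<Longrightarrow> x \<le> m \<and> x \<noteq> m"
      "(\<Sum>x\<in>#C. a (x + (- m))) = (\<Sum>x\<in>#D. a (x + (- m)))" for C D
    using positive[OF that(1)] zero[of D, OF that(2)] that(3) by (metis less_irrefl)
  show False using m
  proof
    assume A: "m \<in># A'"
    show False by (rule absurd[OF A _ eq']) (use A le disj in blast)
  next
    assume B: "m \<in># B'"
    show False by (rule absurd[OF B _ eq'[symmetric]]) (use B le disj in blast)
  qed
qed

section \<open>Graded isomorphisms of shifted free modules\<close>

abbreviation shifted_free ::
    "('a, 'm) ring_scheme \<Rightarrow> ('g::ab_group_add \<Rightarrow> 'a set) \<Rightarrow> nat \<Rightarrow> (nat \<Rightarrow> 'g) \<Rightarrow>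
      (nat \<Rightarrow> 'a, 'a, 'g) graded_rmodule"
  where "shifted_free R grade m \<alpha> \<equiv> direct_sum m (\<lambda>i. shifted_regular R grade (\<alpha> i))"

lemma shifted_free_simps:
  "carrier (shifted_free R grade m \<alpha>) = (\<Pi>\<^sub>E i\<in>{..<m}. carrier R)"
  "madd (shifted_free R grade m \<alpha>) x y = (\<lambda>i\<in>{..<m}. x i \<oplus>\<^bsub>R\<^esub> y i)"
  "ract (shifted_free R grade m \<alpha>) x r = (\<lambda>i\<in>{..<m}. x i \<otimes>\<^bsub>R\<^esub> r)"
  "component (shifted_free R grade m \<alpha>) \<gamma> = (\<Pi>\<^sub>E i\<in>{..<m}. grade (\<alpha> i + \<gamma>))"
  by (auto simp: direct_sum_def shifted_regular_def)

context graded_ring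
begin

lemma grade_carrier: "x \<in> grade \<gamma> \<Longrightarrow> x \<in> carrier R"
  using additive_subgroup.a_Hcarr[OF grade_subgroup] .

lemma zero_in_grade: "\<zero> \<in> grade \<gamma>"
  using additive_subgroup.zero_closed[OF grade_subgroup] .

lemma finsum_in_grade:
  assumes "\<And>t. t \<in> F \<Longrightarrow> x t \<in> grade \<gamma>"
  shows "(\<Oplus>t\<in>F. x t) \<in> grade \<gamma>"
  using assms
proof (induction F rule: infinite_finite_induct)
  case (insert t F)
  then have "(\<Oplus>t\<in>insert t F. x t) = x t \<oplus> (\<Oplus>t\<in>F. x t)"
    by (intro finsum_insert) (auto intro: grade_carrier)
  then show ?case using insert by (simp add: additive_subgroup.a_closed[OF grade_subgroup])
qed (simp_all add: zero_in_grade)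

text \<open>
  A homogeneous element has only one decomposition into homogeneous components, the one
  concentrated in its own degree.
\<close>

lemma homogeneous_finsum_unique:
  assumes fin: "finite F" and hom: "\<And>\<delta>. c \<delta> \<in> grade \<delta>" and ker: "\<And>\<delta>. \<delta> \<notin> F \<Longrightarrow> c \<delta> = \<zero>"
    and sum: "(\<Oplus>\<delta>\<in>F. c \<delta>) \<in> grade \<gamma>" and ne: "\<delta> \<noteq> \<gamma>"
  shows "c \<delta> = \<zero>"
proof -
  define x where "x = (\<Oplus>\<delta>\<in>F. c \<delta>)"
  define c' where "c' = (\<lambda>\<delta>. if \<delta> = \<gamma> then x else \<zero>)"
  have x: "x \<in> grade \<gamma>" using sum by (simp add: x_def)
  note ex1 = grade_decomp[OF grade_carrier[OF x]]
  have supp: "{\<delta>. c \<delta> \<noteq> \<zero>} \<subseteq> F" using ker by auto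
  have "(\<Oplus>\<delta>\<in>F. c \<delta>) = (\<Oplus>\<delta>\<in>{\<delta>. c \<delta> \<noteq> \<zero>}. c \<delta>)"
    using fin supp hom by (intro add.finprod_mono_neutral_cong_left[symmetric]) (auto intro: grade_carrier)
  then have "(\<forall>\<gamma>. c \<gamma> \<in> grade \<gamma>) \<and> finite {\<gamma>. c \<gamma> \<noteq> \<zero>} \<and> x = (\<Oplus>\<gamma>\<in>{\<gamma>. c \<gamma> \<noteq> \<zero>}. c \<gamma>)"
    using hom finite_subset[OF supp fin] by (simp add: x_def)
  moreover have "(\<forall>\<gamma>. c' \<gamma> \<in> grade \<gamma>) \<and> finite {\<gamma>. c' \<gamma> \<noteq> \<zero>} \<and> x = (\<Oplus>\<gamma>\<in>{\<gamma>. c' \<gamma> \<noteq> \<zero>}. c' \<gamma>)"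
  proof -
    have "{\<delta>. c' \<delta> \<noteq> \<zero>} = (if x = \<zero> then {} else {\<gamma>})" by (auto simp: c'_def)
    then show ?thesis using x grade_carrier[OF x] by (auto simp: c'_def zero_in_grade)
  qed
  ultimately have "c = c'" using ex1 by blast
  then show ?thesis using ne by (simp add: c'_def)
qed

lemma additive_map_zero:
  assumes f: "\<And>x. x \<in> carrier (shifted_free R grade m \<alpha>) \<Longrightarrow> f x \<in> carrier (shifted_free R grade n \<beta>)"
    and add: "\<And>x y. x \<in> carrier (shifted_free R grade m \<alpha>) \<Longrightarrow> y \<in> carrier (shifted_free R grade m \<alpha>) \<Longrightarrow>
      f (madd (shifted_free R grade m \<alpha>) x y) = madd (shifted_free R grade n \<beta>) (f x) (f y)"
  shows "f (\<lambda>i\<in>{..<m}. \<zero>) = (\<lambda>j\<in>{..<n}. \<zero>)"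
proof
  fix j
  let ?z = "\<lambda>i\<in>{..<m}. \<zero>"
  have z: "?z \<in> carrier (shifted_free R grade m \<alpha>)" by (auto simp: shifted_free_simps)
  have "madd (shifted_free R grade m \<alpha>) ?z ?z = ?z" by (auto simp: shifted_free_simps)
  then have *: "f ?z = (\<lambda>j\<in>{..<n}. f ?z j \<oplus> f ?z j)"
    using add[OF z z] by (simp add: shifted_free_simps)
  have fz: "f ?z \<in> (\<Pi>\<^sub>E i\<in>{..<n}. carrier R)" using f[OF z] by (simp add: shifted_free_simps)
  show "f ?z j = (\<lambda>j\<in>{..<n}. \<zero>) j"
  proof (cases "j < n")
    case True
    then have "f ?z j = f ?z j \<oplus> f ?z j" using fun_cong[OF *, of j] by simp
    moreover have "f ?z j \<in> carrier R" using fz True by (auto simp: PiE_def Pi_def)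
    ultimately show ?thesis using True by (metis add.l_cancel_one' lessThan_iff restrict_apply')
  next
    case False
    then show ?thesis using PiE_arb[OF fz] by simp
  qed
qed

text \<open>
  Sums of many elements of a shifted free module are formed componentwise in the ring, as the module
  record only provides a binary addition.
\<close>

lemma additive_map_finsum:
  assumes f: "\<And>x. x \<in> carrier (shifted_free R grade m \<alpha>) \<Longrightarrow> f x \<in> carrier (shifted_free R grade n \<beta>)"
    and add: "\<And>x y. x \<in> carrier (shifted_free R grade m \<alpha>) \<Longrightarrow> y \<in> carrier (shifted_free R grade m \<alpha>) \<Longrightarrow>
      f (madd (shifted_free R grade m \<alpha>) x y) = madd (shifted_free R grade n \<beta>) (f x) (f y)"
    and "finite F" and "\<And>t. t \<in> F \<Longrightarrow> x t \<in> carrier (shifted_free R grade m \<alpha>)"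
  shows "f (\<lambda>i\<in>{..<m}. \<Oplus>t\<in>F. x t i) = (\<lambda>j\<in>{..<n}. \<Oplus>t\<in>F. f (x t) j)"
  using assms(3,4)
proof (induction F rule: finite_induct)
  case empty
  show ?case using additive_map_zero[of m \<alpha> f n \<beta>, OF f add] by (simp only: finsum_empty)
next
  case (insert t F)
  have xc: "x s \<in> (\<Pi>\<^sub>E i\<in>{..<m}. carrier R)" if "s \<in> insert t F" for s
    using insert.prems[OF that] by (simp add: shifted_free_simps)
  have xi: "x s i \<in> carrier R" if "s \<in> insert t F" "i < m" for s i
    using xc that by (auto simp: PiE_def Pi_def)
  have fx: "f (x s) j \<in> carrier R" if "s \<in> insert t F" "j < n" for s j
    using f[OF insert.prems[OF that(1)]] that by (auto simp: shifted_free_simps PiE_def Pi_def)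
  have rest: "(\<lambda>i\<in>{..<m}. \<Oplus>s\<in>F. x s i) \<in> carrier (shifted_free R grade m \<alpha>)"
    using xi by (auto simp: shifted_free_simps intro!: finsum_closed)
  have split: "(\<lambda>i\<in>{..<m}. \<Oplus>s\<in>insert t F. x s i) =
      madd (shifted_free R grade m \<alpha>) (x t) (\<lambda>i\<in>{..<m}. \<Oplus>s\<in>F. x s i)"
    using insert.hyps xi by (intro ext) (simp add: shifted_free_simps Pi_def)
  have "f (\<lambda>i\<in>{..<m}. \<Oplus>s\<in>insert t F. x s i) =
      madd (shifted_free R grade n \<beta>) (f (x t)) (\<lambda>j\<in>{..<n}. \<Oplus>s\<in>F. f (x s) j)"
    unfolding split using add[OF insert.prems[OF insertI1] rest] insert.IH[OF insert.prems[OF insertI2]]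
    by (simp only:)
  also have "\<dots> = (\<lambda>j\<in>{..<n}. \<Oplus>s\<in>insert t F. f (x s) j)"
    using insert.hyps fx by (intro ext) (simp add: shifted_free_simps Pi_def)
  finally show ?case .
qed

lemma graded_decomposition:
  assumes x: "x \<in> carrier (shifted_free R grade m \<alpha>)"
  obtains D X where "finite D" "\<And>\<delta>. X \<delta> \<in> component (shifted_free R grade m \<alpha>) \<delta>"
    "\<And>\<delta>. \<delta> \<notin> D \<Longrightarrow> X \<delta> = (\<lambda>i\<in>{..<m}. \<zero>)" "x = (\<lambda>i\<in>{..<m}. \<Oplus>\<delta>\<in>D. X \<delta> i)"
proof -
  have xi: "x i \<in> carrier R" if "i < m" for i using x that by (auto simp: shifted_free_simps PiE_def Pi_def)
  have "\<exists>c. (\<forall>\<gamma>. c \<gamma> \<in> grade \<gamma>) \<and> finite {\<gamma>. c \<gamma> \<noteq> \<zero>} \<and> x i = (\<Oplus>\<gamma>\<in>{\<gamma>. c \<gamma> \<noteq> \<zero>}. c \<gamma>)"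
    if "i < m" for i using grade_decomp[OF xi[OF that]] by blast
  then obtain c where c: "\<And>i \<gamma>. i < m \<Longrightarrow> c i \<gamma> \<in> grade \<gamma>" "\<And>i. i < m \<Longrightarrow> finite {\<gamma>. c i \<gamma> \<noteq> \<zero>}"
    "\<And>i. i < m \<Longrightarrow> x i = (\<Oplus>\<gamma>\<in>{\<gamma>. c i \<gamma> \<noteq> \<zero>}. c i \<gamma>)"
    by metis
  \<comment> \<open>The \<open>i\<close>-th entry of a module element of degree \<open>\<delta>\<close> has degree \<open>\<alpha> i + \<delta>\<close> in the ring.\<close>
  define D where "D = (\<Union>i<m. (\<lambda>\<gamma>. \<gamma> - \<alpha> i) ` {\<gamma>. c i \<gamma> \<noteq> \<zero>})"
  define X where "X = (\<lambda>\<delta>. \<lambda>i\<in>{..<m}. c i (\<alpha> i + \<delta>))"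
  have D: "finite D" using c(2) by (auto simp: D_def)
  have outside: "c i (\<alpha> i + \<delta>) = \<zero>" if "\<delta> \<notin> D" "i < m" for i \<delta>
  proof (rule ccontr)
    assume "c i (\<alpha> i + \<delta>) \<noteq> \<zero>"
    then have "(\<alpha> i + \<delta>) - \<alpha> i \<in> D" using that(2) unfolding D_def by blast
    then show False using that by simp
  qed
  have "x i = (\<Oplus>\<delta>\<in>D. c i (\<alpha> i + \<delta>))" if i: "i < m" for i
  proof -
    have inj: "inj_on (\<lambda>\<delta>. \<alpha> i + \<delta>) D" by (auto simp: inj_on_def)
    have sub: "{\<gamma>. c i \<gamma> \<noteq> \<zero>} \<subseteq> (\<lambda>\<delta>. \<alpha> i + \<delta>) ` D"
    proof
      fix \<gamma> assume "\<gamma> \<in> {\<gamma>. c i \<gamma> \<noteq> \<zero>}"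
      then have "\<gamma> - \<alpha> i \<in> D" using i by (auto simp: D_def)
      then show "\<gamma> \<in> (\<lambda>\<delta>. \<alpha> i + \<delta>) ` D" by (intro image_eqI[of _ _ "\<gamma> - \<alpha> i"]) auto
    qed
    have "x i = (\<Oplus>\<gamma>\<in>(\<lambda>\<delta>. \<alpha> i + \<delta>) ` D. c i \<gamma>)"
      unfolding c(3)[OF i] using D sub c(1)[OF i]
      by (intro add.finprod_mono_neutral_cong_left) (auto intro: grade_carrier)
    also have "\<dots> = (\<Oplus>\<delta>\<in>D. c i (\<alpha> i + \<delta>))"
      using c(1)[OF i] by (intro finsum_reindex inj) (auto intro: grade_carrier)
    finally show ?thesis .
  qed
  then have "x = (\<lambda>i\<in>{..<m}. \<Oplus>\<delta>\<in>D. X \<delta> i)"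
    using x by (intro ext) (auto simp: X_def shifted_free_simps PiE_def extensional_def)
  then show ?thesis
    using D c(1) outside
    by (intro that[of D X]) (auto simp: X_def shifted_free_simps)
qed

text \<open>
  The point is that the inverse \<open>g\<close> preserves degrees. Let \<open>y\<close> have degree \<open>\<gamma>\<close> and decompose \<open>g y\<close> into
  components \<open>X \<delta>\<close>. Then \<open>y\<close> is the sum of the \<open>f (X \<delta>)\<close>, which have degree \<open>\<delta>\<close>. By uniqueness
  \<open>f (X \<delta>)\<close>, and hence \<open>X \<delta>\<close>, vanishes for \<open>\<delta> \<noteq> \<gamma>\<close>.
\<close>

lemma graded_iso_sym:
  assumes "graded_iso R (shifted_free R grade m \<alpha>) (shifted_free R grade n \<beta>)"
  shows "graded_iso R (shifted_free R grade n \<beta>) (shifted_free R grade m \<alpha>)"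
proof -
  let ?M = "shifted_free R grade m \<alpha>" and ?N = "shifted_free R grade n \<beta>"
  obtain f where f: "bij_betw f (carrier ?M) (carrier ?N) \<and>
      (\<forall>x\<in>carrier ?M. \<forall>y\<in>carrier ?M. f (madd ?M x y) = madd ?N (f x) (f y)) \<and>
      (\<forall>x\<in>carrier ?M. \<forall>r\<in>carrier R. f (ract ?M x r) = ract ?N (f x) r) \<and>
      (\<forall>\<gamma>. f ` component ?M \<gamma> \<subseteq> component ?N \<gamma>)"
    using assms unfolding graded_iso_def by (rule exE)
  note bij = f[THEN conjunct1]
    and add = f[THEN conjunct2, THEN conjunct1, rule_format]
    and act = f[THEN conjunct2, THEN conjunct2, THEN conjunct1, rule_format]
    and comp = f[THEN conjunct2, THEN conjunct2, THEN conjunct2, rule_format]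
  have fcl: "\<And>x. x \<in> carrier ?M \<Longrightarrow> f x \<in> carrier ?N" using bij by (auto simp: bij_betw_def)
  define g where "g = inv_into (carrier ?M) f"
  have g: "bij_betw g (carrier ?N) (carrier ?M)"
    using bij by (simp add: g_def bij_betw_inv_into)
  have gf: "\<And>x. x \<in> carrier ?M \<Longrightarrow> g (f x) = x" and fg: "\<And>y. y \<in> carrier ?N \<Longrightarrow> f (g y) = y"
    using bij by (auto simp: g_def bij_betw_inv_into_left bij_betw_inv_into_right)
  have gcl: "\<And>y. y \<in> carrier ?N \<Longrightarrow> g y \<in> carrier ?M" using g by (auto simp: bij_betw_def)
  have M_closed: "madd ?M x y \<in> carrier ?M" "ract ?M x r \<in> carrier ?M"
    if "x \<in> carrier ?M" "y \<in> carrier ?M" "r \<in> carrier R" for x y r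
    using that by (auto simp: shifted_free_simps PiE_def Pi_def)
  have compM: "\<And>x \<gamma>. x \<in> component ?M \<gamma> \<Longrightarrow> x \<in> carrier ?M"
    by (auto simp: shifted_free_simps PiE_def Pi_def intro: grade_carrier)
  have compN: "\<And>x \<gamma>. x \<in> component ?N \<gamma> \<Longrightarrow> x \<in> carrier ?N"
    by (auto simp: shifted_free_simps PiE_def Pi_def intro: grade_carrier)
  have gadd: "g (madd ?N x y) = madd ?M (g x) (g y)" if "x \<in> carrier ?N" "y \<in> carrier ?N" for x y
    using gf[OF M_closed(1)[OF gcl gcl zero_closed], OF that] add[OF gcl gcl, OF that] fg that by simp
  have gact: "g (ract ?N x r) = ract ?M (g x) r" if "x \<in> carrier ?N" "r \<in> carrier R" for x r
    using gf[OF M_closed(2)[OF gcl gcl], OF that(1) that(1) that(2)] act[OF gcl that(2), OF that(1)] fg that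
    by simp
  have gcomp: "g y \<in> component ?M \<gamma>" if y: "y \<in> component ?N \<gamma>" for y \<gamma>
  proof -
    have yN: "y \<in> carrier ?N" using compN[OF y] .
    obtain D X where D: "finite D" and X: "\<And>\<delta>. X \<delta> \<in> component ?M \<delta>"
      and out: "\<And>\<delta>. \<delta> \<notin> D \<Longrightarrow> X \<delta> = (\<lambda>i\<in>{..<m}. \<zero>)"
      and gy: "g y = (\<lambda>i\<in>{..<m}. \<Oplus>\<delta>\<in>D. X \<delta> i)"
      using graded_decomposition[OF gcl[OF yN]] by blast
    have f0: "f (\<lambda>i\<in>{..<m}. \<zero>) = (\<lambda>j\<in>{..<n}. \<zero>)"
      using additive_map_zero[of m \<alpha> f n \<beta>, OF fcl add] .
    have fX: "f (X \<delta>) \<in> component ?N \<delta>" for \<delta> using comp X by blast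
    have y_eq: "y = (\<lambda>j\<in>{..<n}. \<Oplus>\<delta>\<in>D. f (X \<delta>) j)"
      using additive_map_finsum[of m \<alpha> f n \<beta>, OF fcl add D, of X] compM[OF X] fg[OF yN] gy by simp
    have vanish: "f (X \<delta>) = (\<lambda>j\<in>{..<n}. \<zero>)" if ne: "\<delta> \<noteq> \<gamma>" for \<delta>
    proof
      fix j
      show "f (X \<delta>) j = (\<lambda>j\<in>{..<n}. \<zero>) j"
      proof (cases "j < n")
        case j: True
        let ?c = "\<lambda>\<epsilon>. f (X (\<epsilon> - \<beta> j)) j"
        let ?F = "(\<lambda>\<delta>. \<beta> j + \<delta>) ` D"
        have inj: "inj_on (\<lambda>\<delta>. \<beta> j + \<delta>) D" by (auto simp: inj_on_def)
        have hom: "?c \<epsilon> \<in> grade \<epsilon>" for \<epsilon>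
        proof -
          have "f (X (\<epsilon> - \<beta> j)) j \<in> grade (\<beta> j + (\<epsilon> - \<beta> j))"
            using fX[of "\<epsilon> - \<beta> j"] j by (auto simp: shifted_free_simps PiE_def Pi_def)
          then show ?thesis by simp
        qed
        have "(\<Oplus>\<epsilon>\<in>?F. ?c \<epsilon>) = (\<Oplus>\<delta>\<in>D. f (X \<delta>) j)"
          by (subst finsum_reindex[OF _ inj]) (use hom in \<open>auto intro: grade_carrier\<close>)
        also have "\<dots> = y j" using fun_cong[OF y_eq, of j] j by simp
        also have "\<dots> \<in> grade (\<beta> j + \<gamma>)" using y j by (auto simp: shifted_free_simps PiE_def Pi_def)
        finally have sum: "(\<Oplus>\<epsilon>\<in>?F. ?c \<epsilon>) \<in> grade (\<beta> j + \<gamma>)" .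
        have ker: "?c \<epsilon> = \<zero>" if "\<epsilon> \<notin> ?F" for \<epsilon>
        proof -
          have "\<epsilon> - \<beta> j \<notin> D" using that by (metis add_diff_eq diff_add_cancel add.commute image_eqI)
          then show ?thesis using out f0 j by simp
        qed
        have "\<beta> j + \<delta> \<noteq> \<beta> j + \<gamma>" using ne by simp
        then have "?c (\<beta> j + \<delta>) = \<zero>"
          by (rule homogeneous_finsum_unique[where c = ?c, OF finite_imageI[OF D] hom ker sum, rotated -1])
        then show ?thesis using j by simp
      next
        case False
        then show ?thesis using PiE_arb[OF fX[of \<delta>, unfolded shifted_free_simps]] by simp
      qed
    qed
    have "X \<delta> = (\<lambda>i\<in>{..<m}. \<zero>)" if "\<delta> \<noteq> \<gamma>" for \<delta>
    proof -
      have "(\<lambda>i\<in>{..<m}. \<zero>) \<in> carrier ?M" by (auto simp: shifted_free_simps)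
      then show ?thesis using vanish[OF that] f0 gf compM[OF X] by metis
    qed
    then have "X \<delta> i \<in> grade (\<alpha> i + \<gamma>)" if "i < m" for i \<delta>
      using that X[of \<gamma>] zero_in_grade
      by (cases "\<delta> = \<gamma>") (auto simp: shifted_free_simps PiE_def Pi_def)
    then show ?thesis
      unfolding gy by (auto simp: shifted_free_simps intro!: finsum_in_grade)
  qed
  show ?thesis
    unfolding graded_iso_def
    by (intro exI[of _ g] conjI ballI allI image_subsetI) (fact g gadd gact gcomp)+
qed

end

section \<open>Counting basis vectors in homogeneous components\<close>

text \<open>
  The model is a graded algebra \<open>R\<close> over a field with an idempotent \<open>e\<close> of degree \<open>0\<close>, where
  \<open>scalar c\<close> is \<open>c e\<close> and the elements \<open>vec p\<close> for \<open>p \<in> basis \<delta>\<close> form a finite basis of the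
  component of degree \<open>\<delta>\<close> of \<open>R e\<close>. The function \<open>coord\<close> is defined on all of \<open>R\<close>: it gives
  the coordinates of \<open>x e\<close>. Scalars multiply from the right in order to commute with homomorphisms of
  right modules.
\<close>

locale graded_ring_with_coordinates = graded_ring R grade
  for R (structure) and grade :: "'g::ab_group_add \<Rightarrow> 'a set" +
  fixes basis :: "'g \<Rightarrow> 'p set" and vec :: "'p \<Rightarrow> 'a"
    and coord :: "'a \<Rightarrow> 'p \<Rightarrow> 'k::field" and scalar :: "'k \<Rightarrow> 'a"
  assumes finite_basis: "finite (basis \<delta>)"
    and vec_in_grade: "p \<in> basis \<delta> \<Longrightarrow> vec p \<in> grade \<delta>"
    and scalar_in_grade: "scalar c \<in> grade 0"
    and coord_add: "\<lbrakk>x \<in> carrier R; y \<in> carrier R\<rbrakk> \<Longrightarrow> coord (x \<oplus> y) p = coord x p + coord y p"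
    and coord_scalar: "x \<in> carrier R \<Longrightarrow> coord (x \<otimes> scalar c) p = coord x p * c"
    and coord_vec: "p \<in> basis \<delta> \<Longrightarrow> coord (vec p) q = (if p = q then 1 else 0)"
    and coord_faithful: "\<lbrakk>x \<in> grade \<delta>; \<And>p. p \<in> basis \<delta> \<Longrightarrow> coord x p = 0\<rbrakk> \<Longrightarrow> x \<otimes> scalar 1 = \<zero>"
begin

lemma coord_zero: "coord \<zero> p = 0"
  using coord_add[OF zero_closed zero_closed, of p] by (simp only: l_zero zero_closed add_cancel_right_right)

lemma coord_finsum:
  assumes "\<And>t. t \<in> F \<Longrightarrow> x t \<in> carrier R"
  shows "coord (\<Oplus>t\<in>F. x t) p = (\<Sum>t\<in>F. coord (x t) p)"
  using assms
proof (induction F rule: infinite_finite_induct)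
  case (insert t F)
  then have "(\<Oplus>t\<in>insert t F. x t) = x t \<oplus> (\<Oplus>t\<in>F. x t)"
    by (intro finsum_insert) auto
  then show ?case using insert by (simp add: coord_add finsum_closed Pi_def)
qed (simp_all add: coord_zero)

text \<open>
  The images of the basis vectors in degree \<open>\<gamma>\<close> of the source have coordinates in degree \<open>\<gamma>\<close> of the
  target. With fewer coordinates than vectors some nontrivial combination \<open>z\<close> of the basis vectors has
  an image with all coordinates zero. So \<open>f z\<close>, and by injectivity \<open>z\<close>, is annihilated by \<open>scalar 1\<close>.
  But then all coordinates of \<open>z\<close> vanish, which are the coefficients of the combination.
\<close>

lemma sum_card_basis_le:
  assumes "graded_iso R (shifted_free R grade m \<alpha>) (shifted_free R grade n \<beta>)"
  shows "(\<Sum>i<m. card (basis (\<alpha> i + \<gamma>))) \<le> (\<Sum>j<n. card (basis (\<beta> j + \<gamma>)))"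
proof (rule ccontr)
  let ?M = "shifted_free R grade m \<alpha>" and ?N = "shifted_free R grade n \<beta>"
  assume less: "\<not> ?thesis"
  obtain f where f: "bij_betw f (carrier ?M) (carrier ?N) \<and>
      (\<forall>x\<in>carrier ?M. \<forall>y\<in>carrier ?M. f (madd ?M x y) = madd ?N (f x) (f y)) \<and>
      (\<forall>x\<in>carrier ?M. \<forall>r\<in>carrier R. f (ract ?M x r) = ract ?N (f x) r) \<and>
      (\<forall>\<gamma>. f ` component ?M \<gamma> \<subseteq> component ?N \<gamma>)"
    using assms unfolding graded_iso_def by (rule exE)
  note bij = f[THEN conjunct1]
    and add = f[THEN conjunct2, THEN conjunct1, rule_format]
    and act = f[THEN conjunct2, THEN conjunct2, THEN conjunct1, rule_format]
    and comp = f[THEN conjunct2, THEN conjunct2, THEN conjunct2, rule_format]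
  have fcl: "\<And>x. x \<in> carrier ?M \<Longrightarrow> f x \<in> carrier ?N" using bij by (auto simp: bij_betw_def)
  have inj: "inj_on f (carrier ?M)" using bij by (simp add: bij_betw_def)
  have u: "scalar c \<in> carrier R" for c by (rule grade_carrier[OF scalar_in_grade])
  define S where "S = (SIGMA i:{..<m}. basis (\<alpha> i + \<gamma>))"
  define T where "T = (SIGMA j:{..<n}. basis (\<beta> j + \<gamma>))"
  have fin: "finite S" "finite T" by (auto simp: S_def T_def finite_basis)
  have "card T < card S" using less by (simp add: S_def T_def finite_basis)
  \<comment> \<open>The basis vector with index \<open>(i, p)\<close> is \<open>vec p\<close> in entry \<open>i\<close>.\<close>
  define x where "x = (\<lambda>s. \<lambda>i\<in>{..<m}. if i = fst s then vec (snd s) else \<zero>)"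
  have x: "x s \<in> component ?M \<gamma>" if "s \<in> S" for s
    using that by (auto simp: x_def S_def shifted_free_simps zero_in_grade vec_in_grade)
  have xM: "x s \<in> carrier ?M" if "s \<in> S" for s
    using x[OF that] by (auto simp: shifted_free_simps PiE_def Pi_def intro: grade_carrier)
  have y: "f (x s) j \<in> grade (\<beta> j + \<gamma>)" if "s \<in> S" "j < n" for s j
    using comp[of \<gamma>] x[OF that(1)] that(2) by (auto simp: shifted_free_simps PiE_def Pi_def)
  obtain c where c: "\<exists>s\<in>S. c s \<noteq> 0"
    and sol: "\<And>t. t \<in> T \<Longrightarrow> (\<Sum>s\<in>S. coord (f (x s) (fst t)) (snd t) * c s) = 0"
    using underdetermined_system_has_nontrivial_solution[OF fin(2,1) \<open>card T < card S\<close>,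
        of "\<lambda>t s. coord (f (x s) (fst t)) (snd t)"] by blast
  define z where "z = (\<lambda>i\<in>{..<m}. \<Oplus>s\<in>S. ract ?M (x s) (scalar (c s)) i)"
  have xu: "ract ?M (x s) (scalar (c s)) \<in> carrier ?M" if "s \<in> S" for s
    using xM[OF that] u by (auto simp: shifted_free_simps PiE_def Pi_def)
  have xui: "x s i \<otimes> scalar (c s) \<in> carrier R" "x s i \<in> carrier R" if "s \<in> S" "i < m" for s i
    using xM[OF that(1)] that(2) u by (auto simp: shifted_free_simps PiE_def Pi_def)
  have z_eq: "z i = (\<Oplus>s\<in>S. x s i \<otimes> scalar (c s))" if "i < m" for i
    using that by (simp add: z_def shifted_free_simps)
  have zM: "z \<in> carrier ?M"
    unfolding shifted_free_simps using xui
    by (intro PiE_I) (simp add: z_eq finsum_closed Pi_def, simp add: z_def)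
  have fz: "f z = (\<lambda>j\<in>{..<n}. \<Oplus>s\<in>S. f (x s) j \<otimes> scalar (c s))"
  proof -
    have "f z = (\<lambda>j\<in>{..<n}. \<Oplus>s\<in>S. f (ract ?M (x s) (scalar (c s))) j)"
      unfolding z_def using additive_map_finsum[of m \<alpha> f n \<beta>, OF fcl add fin(1) xu] .
    also have "\<dots> = (\<lambda>j\<in>{..<n}. \<Oplus>s\<in>S. f (x s) j \<otimes> scalar (c s))"
    proof (intro restrict_ext finsum_cong')
      fix j s
      assume j: "j \<in> {..<n}" and s: "s \<in> S"
      show "f (ract ?M (x s) (scalar (c s))) j = f (x s) j \<otimes> scalar (c s)"
        unfolding act[OF xM[OF s] u] using j by (simp add: shifted_free_simps)
    next
      fix j
      assume "j \<in> {..<n}"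
      then show "(\<lambda>s. f (x s) j \<otimes> scalar (c s)) \<in> S \<rightarrow> carrier R"
        using y u by (auto intro!: m_closed intro: grade_carrier)
    qed simp
    finally show ?thesis .
  qed
  have kill: "f z j \<otimes> scalar 1 = \<zero>" if j: "j < n" for j
  proof (rule coord_faithful)
    have yu: "f (x s) j \<otimes> scalar (c s) \<in> grade (\<beta> j + \<gamma>)" if "s \<in> S" for s
      using grade_mult[OF y[OF that j] scalar_in_grade] by simp
    show "f z j \<in> grade (\<beta> j + \<gamma>)"
      using j yu by (simp add: fz finsum_in_grade)
    show "coord (f z j) p = 0" if "p \<in> basis (\<beta> j + \<gamma>)" for p
    proof -
      have "coord (f z j) p = (\<Sum>s\<in>S. coord (f (x s) j \<otimes> scalar (c s)) p)"
        using j coord_finsum[OF grade_carrier[OF yu], of S] by (simp add: fz)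
      also have "\<dots> = (\<Sum>s\<in>S. coord (f (x s) j) p * c s)"
        using j y by (intro sum.cong refl coord_scalar) (blast intro: grade_carrier)
      also have "\<dots> = 0" using sol[of "(j, p)"] that j by (simp add: T_def)
      finally show ?thesis .
    qed
  qed
  have "f (ract ?M z (scalar 1)) = ract ?N (f z) (scalar 1)" by (rule act[OF zM u])
  also have "\<dots> = (\<lambda>j\<in>{..<n}. \<zero>)"
    unfolding shifted_free_simps by (intro restrict_ext) (simp add: kill)
  also have "\<dots> = f (\<lambda>i\<in>{..<m}. \<zero>)"
    by (rule additive_map_zero[of m \<alpha> f n \<beta>, OF fcl add, symmetric])
  finally have f_eq: "f (ract ?M z (scalar 1)) = f (\<lambda>i\<in>{..<m}. \<zero>)" .
  have "ract ?M z (scalar 1) \<in> carrier ?M" "(\<lambda>i\<in>{..<m}. \<zero>) \<in> carrier ?M"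
    using zM u by (auto simp: shifted_free_simps PiE_def Pi_def)
  then have z0: "ract ?M z (scalar 1) = (\<lambda>i\<in>{..<m}. \<zero>)"
    by (rule inj[THEN inj_onD, OF f_eq])
  obtain i p where ip: "(i, p) \<in> S" "c (i, p) \<noteq> 0" using c by auto
  then have i: "i < m" and p: "p \<in> basis (\<alpha> i + \<gamma>)" by (auto simp: S_def)
  have coord_x: "coord (x s i) p * c s = (if s = (i, p) then c s else 0)" if "s \<in> S" for s
    using that i by (auto simp: x_def S_def coord_zero coord_vec split: if_splits prod.splits)
  have "0 = coord (ract ?M z (scalar 1) i) p" using i by (simp add: z0 coord_zero)
  also have "\<dots> = coord (z i) p"
    using i zM coord_scalar[of "z i" 1 p] by (auto simp: shifted_free_simps PiE_def Pi_def)
  also have "\<dots> = (\<Sum>s\<in>S. coord (x s i) p * c s)"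
    using xui i by (simp add: z_eq coord_finsum coord_scalar)
  also have "\<dots> = (\<Sum>s\<in>S. if s = (i, p) then c s else 0)"
    using coord_x by (rule sum.cong[OF refl])
  also have "\<dots> = c (i, p)" using fin ip by simp
  finally show False using ip by simp
qed

end

lemma (in graded_ring_with_coordinates) sum_card_basis_eq:
  assumes "graded_iso R (shifted_free R grade m \<alpha>) (shifted_free R grade n \<beta>)"
  shows "(\<Sum>i<m. card (basis (\<alpha> i + \<gamma>))) = (\<Sum>j<n. card (basis (\<beta> j + \<gamma>)))"
  using sum_card_basis_le[OF assms] sum_card_basis_le[OF graded_iso_sym[OF assms]] by (rule antisym)

section \<open>Homogeneous components in the free algebra\<close>

text \<open>
  The monomials in the step are those that occur in \<open>p\<close>, so a restriction on the words of \<open>p\<close> need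
  not be part of the induction statement.
\<close>

lemma poly_mapping_span_induct [case_names zero single add]:
  fixes p :: "'w \<Rightarrow>\<^sub>0 'k::comm_monoid_add"
  assumes "P 0" and "\<And>w. w \<in> Poly_Mapping.keys p \<Longrightarrow> P (Poly_Mapping.single w (Poly_Mapping.lookup p w))"
    and "\<And>x y. P x \<Longrightarrow> P y \<Longrightarrow> P (x + y)"
  shows "P p"
proof -
  have "P (\<Sum>w\<in>W. Poly_Mapping.single w (Poly_Mapping.lookup p w))"
    if "W \<subseteq> Poly_Mapping.keys p" for W
    using that by (induction W rule: infinite_finite_induct) (use assms in auto)
  moreover have "p = (\<Sum>w\<in>Poly_Mapping.keys p. Poly_Mapping.single w (Poly_Mapping.lookup p w))"
    by (intro poly_mapping_eqI) (simp add: lookup_sum lookup_single when_def in_keys_iff)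
  ultimately show ?thesis by (metis order_refl)
qed

lemma letters_add [simp]: "letters (u + v) = letters u @ letters v"
  by (simp add: plus_word_def)

lemma letters_zero [simp]: "letters 0 = []"
  by (simp add: zero_word_def)

lemma word_degree_add: "word_degree (u + v) = word_degree u + word_degree v"
  by (simp add: word_degree_def)

definition homogeneous_part :: "int \<Rightarrow> ('v, 'e, 'k::field) path_poly \<Rightarrow> ('v, 'e, 'k) path_poly"
  where "homogeneous_part n p =
    (\<Sum>w | w \<in> Poly_Mapping.keys p \<and> word_degree w = n. Poly_Mapping.single w (Poly_Mapping.lookup p w))"

lemma lookup_homogeneous_part:
  "Poly_Mapping.lookup (homogeneous_part n p) w = (if word_degree w = n then Poly_Mapping.lookup p w else 0)"
proof -
  have "Poly_Mapping.lookup (homogeneous_part n p) w =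
      (\<Sum>w' | w' \<in> Poly_Mapping.keys p \<and> word_degree w' = n. if w' = w then Poly_Mapping.lookup p w else 0)"
    unfolding homogeneous_part_def lookup_sum by (intro sum.cong) (auto simp: lookup_single when_def)
  also have "\<dots> = (if word_degree w = n then Poly_Mapping.lookup p w else 0)"
    by (auto simp: in_keys_iff)
  finally show ?thesis .
qed

lemma keys_homogeneous_part:
  "Poly_Mapping.keys (homogeneous_part n p) = {w \<in> Poly_Mapping.keys p. word_degree w = n}"
  by (auto simp: in_keys_iff lookup_homogeneous_part split: if_splits)

lemma homogeneous_part_add: "homogeneous_part n (p + q) = homogeneous_part n p + homogeneous_part n q"
  by (intro poly_mapping_eqI) (simp add: lookup_homogeneous_part lookup_add)

lemma homogeneous_part_diff: "homogeneous_part n (p - q) = homogeneous_part n p - homogeneous_part n q"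
  by (intro poly_mapping_eqI) (simp add: lookup_homogeneous_part lookup_minus)

lemma homogeneous_part_zero: "homogeneous_part n 0 = 0"
  by (intro poly_mapping_eqI) (simp add: lookup_homogeneous_part)

lemma homogeneous_part_sum: "homogeneous_part n (\<Sum>t\<in>F. g t) = (\<Sum>t\<in>F. homogeneous_part n (g t))"
  by (induction F rule: infinite_finite_induct) (simp_all add: homogeneous_part_zero homogeneous_part_add)

lemma homogeneous_part_single:
  "homogeneous_part n (Poly_Mapping.single w c) = (if word_degree w = n then Poly_Mapping.single w c else 0)"
  by (intro poly_mapping_eqI) (auto simp: lookup_homogeneous_part lookup_single when_def)

lemma homogeneous_part_of_homogeneous:
  assumes "\<And>w. w \<in> Poly_Mapping.keys p \<Longrightarrow> word_degree w = d"
  shows "homogeneous_part n p = (if n = d then p else 0)"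
  using assms by (intro poly_mapping_eqI) (auto simp: lookup_homogeneous_part in_keys_iff)

lemma sum_homogeneous_parts:
  "(\<Sum>n\<in>word_degree ` Poly_Mapping.keys p. homogeneous_part n p) = p"
  by (intro poly_mapping_eqI) (auto simp: lookup_sum lookup_homogeneous_part in_keys_iff)

lemma homogeneous_part_single_mult:
  "homogeneous_part n (Poly_Mapping.single w c * x) = Poly_Mapping.single w c * homogeneous_part (n - word_degree w) x"
  by (induction x rule: poly_mapping_span_induct)
     (auto simp: homogeneous_part_zero homogeneous_part_add distrib_left mult_single
        homogeneous_part_single word_degree_add)

lemma homogeneous_part_mult_single:
  "homogeneous_part n (x * Poly_Mapping.single w c) = homogeneous_part (n - word_degree w) x * Poly_Mapping.single w c"
  by (induction x rule: poly_mapping_span_induct)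
     (auto simp: homogeneous_part_zero homogeneous_part_add distrib_right mult_single
        homogeneous_part_single word_degree_add)

section \<open>The ideal of the Leavitt relations\<close>

lemma free_algebra_simps:
  "monoid.mult (free_algebra G) = (*)" "one (free_algebra G) = 1"
  "zero (free_algebra G) = 0" "add (free_algebra G) = (+)"
  by (simp_all add: free_algebra_def)

lemma free_algebra_carrier_iff:
  "p \<in> carrier (free_algebra G) \<longleftrightarrow> (\<forall>w\<in>Poly_Mapping.keys p. set (letters w) \<subseteq> graph_letters G)"
  by (simp add: free_algebra_def)

lemma nonunital_part_iff:
  "p \<in> nonunital_part G \<longleftrightarrow>
    (\<forall>w\<in>Poly_Mapping.keys p. set (letters w) \<subseteq> graph_letters G \<and> letters w \<noteq> [])"
  by (auto simp: nonunital_part_def free_algebra_carrier_iff zero_word_def)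
     (metis word.exhaust_sel)

lemma nonunital_in_carrier: "p \<in> nonunital_part G \<Longrightarrow> p \<in> carrier (free_algebra G)"
  by (simp add: nonunital_part_def)

lemma uminus_free_algebra:
  fixes p :: "('v, 'e, 'k::field) path_poly"
  assumes "p \<in> carrier (free_algebra G)"
  shows "\<ominus>\<^bsub>free_algebra G\<^esub> p = - p"
proof -
  interpret A: ring "free_algebra G :: ('v, 'e, 'k) path_poly ring" by (rule ring_free_algebra)
  show ?thesis
    using assms by (intro A.minus_equality) (simp_all add: free_algebra_simps free_algebra_carrier_iff)
qed

lemma nonunital_zero: "0 \<in> nonunital_part G"
  by (simp add: nonunital_part_iff)

lemma nonunital_add: "p \<in> nonunital_part G \<Longrightarrow> q \<in> nonunital_part G \<Longrightarrow> p + q \<in> nonunital_part G"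
  using Poly_Mapping.keys_add[of p q] by (auto simp: nonunital_part_iff)

lemma nonunital_uminus: "p \<in> nonunital_part G \<Longrightarrow> - p \<in> nonunital_part G"
  by (simp add: nonunital_part_iff)

lemma nonunital_diff: "p \<in> nonunital_part G \<Longrightarrow> q \<in> nonunital_part G \<Longrightarrow> p - q \<in> nonunital_part G"
  using nonunital_add[OF _ nonunital_uminus, of p G q] by simp

lemma nonunital_mult: "p \<in> nonunital_part G \<Longrightarrow> q \<in> nonunital_part G \<Longrightarrow> p * q \<in> nonunital_part G"
  using Poly_Mapping.keys_mult[of p q] by (fastforce simp: nonunital_part_iff)

lemma nonunital_sum: "(\<And>t. t \<in> F \<Longrightarrow> g t \<in> nonunital_part G) \<Longrightarrow> (\<Sum>t\<in>F. g t) \<in> nonunital_part G"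
  by (induction F rule: infinite_finite_induct) (auto simp: nonunital_zero nonunital_add)

lemma nonunital_single:
  "set (letters w) \<subseteq> graph_letters G \<Longrightarrow> letters w \<noteq> [] \<Longrightarrow> Poly_Mapping.single w c \<in> nonunital_part G"
  by (simp add: nonunital_part_iff)

lemma graph_letters_simps [simp]:
  "Vertex v \<in> graph_letters G \<longleftrightarrow> v \<in> verts G"
  "Edge e \<in> graph_letters G \<longleftrightarrow> e \<in> arcs G"
  "Ghost e \<in> graph_letters G \<longleftrightarrow> e \<in> arcs G"
  by (auto simp: graph_letters_def)

context fin_digraph
begin

lemma leavitt_relations_nonunital: "leavitt_relations G \<subseteq> nonunital_part G"
  unfolding leavitt_relations_def
  by (auto simp: regular_def intro!: nonunital_diff nonunital_mult nonunital_single nonunital_zero nonunital_sum)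

lemma ideal_leavitt: "ideal (leavitt_ideal G :: ('a, 'b, 'k::field) path_poly set) (free_algebra G)"
  unfolding leavitt_ideal_def
  using leavitt_relations_nonunital nonunital_in_carrier
  by (intro ring.genideal_ideal ring_free_algebra) blast

lemma relation_in_ideal: "r \<in> leavitt_relations G \<Longrightarrow> r \<in> leavitt_ideal G"
  unfolding leavitt_ideal_def
  using ring.genideal_self[OF ring_free_algebra, of "leavitt_relations G" G]
    leavitt_relations_nonunital nonunital_in_carrier by blast

lemma leavitt_ideal_minimal:
  "ideal J (free_algebra G) \<Longrightarrow> leavitt_relations G \<subseteq> J \<Longrightarrow> leavitt_ideal G \<subseteq> J"
  unfolding leavitt_ideal_def by (rule ring.genideal_minimal[OF ring_free_algebra])

text \<open>
  Since monomials span the free algebra, closure under multiplication by monomials suffices; negation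
  is multiplication by the constant \<open>- 1\<close>.
\<close>

lemma ideal_free_algebraI:
  fixes J :: "('a, 'b, 'k::field) path_poly set"
  assumes "J \<subseteq> carrier (free_algebra G)" "0 \<in> J" "\<And>x y. x \<in> J \<Longrightarrow> y \<in> J \<Longrightarrow> x + y \<in> J"
    and left: "\<And>w c x. \<lbrakk>x \<in> J; set (letters w) \<subseteq> graph_letters G\<rbrakk> \<Longrightarrow> Poly_Mapping.single w c * x \<in> J"
    and right: "\<And>w c x. \<lbrakk>x \<in> J; set (letters w) \<subseteq> graph_letters G\<rbrakk> \<Longrightarrow> x * Poly_Mapping.single w c \<in> J"
  shows "ideal J (free_algebra G)"
proof (rule idealI[OF ring_free_algebra])
  interpret A: ring "free_algebra G :: ('a, 'b, 'k) path_poly ring" by (rule ring_free_algebra)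
  show "x \<otimes>\<^bsub>free_algebra G\<^esub> a \<in> J" if "a \<in> J" "x \<in> carrier (free_algebra G)" for a x
    unfolding free_algebra_simps
    by (rule poly_mapping_span_induct[where P = "\<lambda>x. x * a \<in> J" and p = x])
      (use assms(2,3) left[OF that(1)] that(2) in \<open>auto simp: distrib_right free_algebra_carrier_iff\<close>)
  show "a \<otimes>\<^bsub>free_algebra G\<^esub> x \<in> J" if "a \<in> J" "x \<in> carrier (free_algebra G)" for a x
    unfolding free_algebra_simps
    by (rule poly_mapping_span_induct[where P = "\<lambda>x. a * x \<in> J" and p = x])
      (use assms(2,3) right[OF that(1)] that(2) in \<open>auto simp: distrib_left free_algebra_carrier_iff\<close>)
  show "subgroup J (add_monoid (free_algebra G))"
  proof (rule A.add.subgroupI)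
    show "J \<noteq> {}" using assms(2) by blast
    show "\<ominus>\<^bsub>free_algebra G\<^esub> a \<in> J" if "a \<in> J" for a
    proof -
      have "Poly_Mapping.single 0 (- 1) * a \<in> J" using left[OF that, of 0] by simp
      then show ?thesis
        using that assms(1) by (simp add: uminus_free_algebra subset_iff single_uminus)
    qed
  qed (use assms in \<open>auto simp: free_algebra_simps\<close>)
qed

lemma
  fixes x y :: "('a, 'b, 'k::field) path_poly"
  shows leavitt_ideal_zero: "(0 :: ('a, 'b, 'k) path_poly) \<in> leavitt_ideal G"
    and leavitt_ideal_add: "x \<in> leavitt_ideal G \<Longrightarrow> y \<in> leavitt_ideal G \<Longrightarrow> x + y \<in> leavitt_ideal G"
    and leavitt_ideal_mult_left:
      "x \<in> leavitt_ideal G \<Longrightarrow> y \<in> carrier (free_algebra G) \<Longrightarrow> y * x \<in> leavitt_ideal G"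
    and leavitt_ideal_mult_right:
      "x \<in> leavitt_ideal G \<Longrightarrow> y \<in> carrier (free_algebra G) \<Longrightarrow> x * y \<in> leavitt_ideal G"
    and leavitt_ideal_uminus: "x \<in> leavitt_ideal G \<Longrightarrow> - x \<in> leavitt_ideal G"
proof -
  interpret I: ideal "leavitt_ideal G :: ('a, 'b, 'k) path_poly set" "free_algebra G" by (rule ideal_leavitt)
  show "0 \<in> (leavitt_ideal G :: ('a, 'b, 'k) path_poly set)"
    using additive_subgroup.zero_closed[OF I.is_additive_subgroup] by (simp add: free_algebra_simps)
  show "x \<in> leavitt_ideal G \<Longrightarrow> y \<in> leavitt_ideal G \<Longrightarrow> x + y \<in> leavitt_ideal G"
    using additive_subgroup.a_closed[OF I.is_additive_subgroup, of x y] by (simp add: free_algebra_simps)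
  show "x \<in> leavitt_ideal G \<Longrightarrow> y \<in> carrier (free_algebra G) \<Longrightarrow> y * x \<in> leavitt_ideal G"
    using I.I_l_closed by (simp add: free_algebra_simps)
  show "x \<in> leavitt_ideal G \<Longrightarrow> y \<in> carrier (free_algebra G) \<Longrightarrow> x * y \<in> leavitt_ideal G"
    using I.I_r_closed by (simp add: free_algebra_simps)
  show "x \<in> leavitt_ideal G \<Longrightarrow> - x \<in> leavitt_ideal G"
    using I.I_l_closed[of x "- 1"] by (simp add: free_algebra_simps free_algebra_carrier_iff)
qed

lemma leavitt_ideal_diff: "x \<in> leavitt_ideal G \<Longrightarrow> y \<in> leavitt_ideal G \<Longrightarrow> x - y \<in> leavitt_ideal G"
  using leavitt_ideal_add[OF _ leavitt_ideal_uminus, of x y] by simp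

lemma leavitt_ideal_sum:
  "(\<And>t. t \<in> F \<Longrightarrow> g t \<in> leavitt_ideal G) \<Longrightarrow> (\<Sum>t\<in>F. g t) \<in> leavitt_ideal G"
  by (induction F rule: infinite_finite_induct) (auto simp: leavitt_ideal_zero leavitt_ideal_add)

lemma leavitt_relation_homogeneous:
  assumes "r \<in> leavitt_relations G"
  shows "homogeneous_part n r \<in> {r, 0}"
  using assms unfolding leavitt_relations_def
  by (auto simp: homogeneous_part_diff homogeneous_part_sum homogeneous_part_zero
      homogeneous_part_single mult_single word_degree_def)

text \<open>
  The elements all of whose components lie in the ideal form an ideal, since multiplication by a
  monomial only shifts the components. It contains the relations, as these are homogeneous.
\<close>

lemma leavitt_ideal_homogeneous_part:
  fixes x :: "('a, 'b, 'k::field) path_poly"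
  assumes "x \<in> leavitt_ideal G"
  shows "homogeneous_part n x \<in> leavitt_ideal G"
proof -
  define J :: "('a, 'b, 'k::field) path_poly set"
    where "J = {x \<in> carrier (free_algebra G). \<forall>n. homogeneous_part n x \<in> leavitt_ideal G}"
  have closed: "Poly_Mapping.single w c \<in> carrier (free_algebra G)"
    if "set (letters w) \<subseteq> graph_letters G" for w and c :: 'k
    using that by (simp add: free_algebra_carrier_iff)
  have "ideal J (free_algebra G)"
  proof (rule ideal_free_algebraI)
    interpret A: ring "free_algebra G :: ('a, 'b, 'k) path_poly ring" by (rule ring_free_algebra)
    show "0 \<in> J" by (simp add: J_def free_algebra_carrier_iff homogeneous_part_zero leavitt_ideal_zero)
    show "x + y \<in> J" if "x \<in> J" "y \<in> J" for x y
      using that A.add.m_closed[of x y]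
      by (auto simp: J_def homogeneous_part_add free_algebra_simps intro: leavitt_ideal_add)
    show "Poly_Mapping.single w c * x \<in> J" if "x \<in> J" "set (letters w) \<subseteq> graph_letters G" for w c x
      using that A.m_closed[OF closed, of w x] leavitt_ideal_mult_left[OF _ closed]
      by (auto simp: J_def homogeneous_part_single_mult free_algebra_simps)
    show "x * Poly_Mapping.single w c \<in> J" if "x \<in> J" "set (letters w) \<subseteq> graph_letters G" for w c x
      using that A.m_closed[OF _ closed, of x w] leavitt_ideal_mult_right[OF _ closed]
      by (auto simp: J_def homogeneous_part_mult_single free_algebra_simps)
  qed (auto simp: J_def)
  moreover have "leavitt_relations G \<subseteq> J"
  proof
    fix r :: "('a, 'b, 'k::field) path_poly"
    assume r: "r \<in> leavitt_relations G"
    then have "homogeneous_part n r \<in> leavitt_ideal G" for n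
      using leavitt_relation_homogeneous[OF r, of n] relation_in_ideal[OF r] leavitt_ideal_zero by auto
    then show "r \<in> J" using r leavitt_relations_nonunital nonunital_in_carrier by (auto simp: J_def)
  qed
  ultimately show ?thesis using leavitt_ideal_minimal assms by (auto simp: J_def)
qed

end

section \<open>The Leavitt path algebra as a graded ring\<close>

context fin_digraph
begin

lemma leavitt_class_eq_iff:
  fixes p q :: "('a, 'b, 'k::field) path_poly"
  assumes "p \<in> carrier (free_algebra G)" "q \<in> carrier (free_algebra G)"
  shows "leavitt_class G p = leavitt_class G q \<longleftrightarrow> p - q \<in> leavitt_ideal G"
proof -
  interpret A: ring "free_algebra G :: ('a, 'b, 'k) path_poly ring" by (rule ring_free_algebra)
  show ?thesis
    using A.quotient_eq_iff_same_a_r_cos[OF ideal_leavitt assms] assms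
    by (simp add: a_minus_def uminus_free_algebra free_algebra_simps)
qed

lemma leavitt_simps:
  fixes p q :: "('a, 'b, 'k::field) path_poly"
  shows leavitt_carrier: "carrier (leavitt_path_algebra G :: ('a, 'b, 'k) path_poly set ring) =
      leavitt_class G ` nonunital_part G"
    and leavitt_zero: "\<zero>\<^bsub>leavitt_path_algebra G\<^esub> = leavitt_class G (0 :: ('a, 'b, 'k) path_poly)"
    and leavitt_one: "\<one>\<^bsub>leavitt_path_algebra G\<^esub> =
      leavitt_class G (\<Sum>v\<in>verts G. vtx v :: ('a, 'b, 'k) path_poly)"
    and leavitt_add: "\<lbrakk>p \<in> nonunital_part G; q \<in> nonunital_part G\<rbrakk> \<Longrightarrow>
      leavitt_class G p \<oplus>\<^bsub>leavitt_path_algebra G\<^esub> leavitt_class G q = leavitt_class G (p + q)"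
    and leavitt_mult: "\<lbrakk>p \<in> nonunital_part G; q \<in> nonunital_part G\<rbrakk> \<Longrightarrow>
      leavitt_class G p \<otimes>\<^bsub>leavitt_path_algebra G\<^esub> leavitt_class G q = leavitt_class G (p * q)"
proof -
  interpret I: ideal "leavitt_ideal G :: ('a, 'b, 'k) path_poly set" "free_algebra G" by (rule ideal_leavitt)
  show "carrier (leavitt_path_algebra G :: ('a, 'b, 'k) path_poly set ring) =
      leavitt_class G ` nonunital_part G"
    by (simp add: leavitt_path_algebra_def)
  show "\<zero>\<^bsub>leavitt_path_algebra G\<^esub> = leavitt_class G (0 :: ('a, 'b, 'k) path_poly)"
    using I.a_coset_add_zero[OF I.a_subset] by (simp add: leavitt_path_algebra_def FactRing_def free_algebra_simps)
  show "\<one>\<^bsub>leavitt_path_algebra G\<^esub> = leavitt_class G (\<Sum>v\<in>verts G. vtx v :: ('a, 'b, 'k) path_poly)"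
    by (simp add: leavitt_path_algebra_def)
  show "leavitt_class G p \<oplus>\<^bsub>leavitt_path_algebra G\<^esub> leavitt_class G q = leavitt_class G (p + q)"
    if "p \<in> nonunital_part G" "q \<in> nonunital_part G"
    using that[THEN nonunital_in_carrier] I.a_rcos_sum[of p q]
    by (simp add: leavitt_path_algebra_def FactRing_def free_algebra_simps)
  show "leavitt_class G p \<otimes>\<^bsub>leavitt_path_algebra G\<^esub> leavitt_class G q = leavitt_class G (p * q)"
    if "p \<in> nonunital_part G" "q \<in> nonunital_part G"
    using that[THEN nonunital_in_carrier] I.rcoset_mult_add[of p q]
    by (simp add: leavitt_path_algebra_def FactRing_def free_algebra_simps)
qed

lemma letter_in_free_algebra:
  "l \<in> graph_letters G \<Longrightarrow> Poly_Mapping.single (Word [l]) c \<in> carrier (free_algebra G)"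
  by (simp add: free_algebra_carrier_iff)

lemma vertex_relation:
  "v \<in> verts G \<Longrightarrow> w \<in> verts G \<Longrightarrow> vtx v * vtx w - (if v = w then vtx w else 0) \<in> leavitt_ideal G"
  by (rule relation_in_ideal) (unfold leavitt_relations_def, blast)

lemma tail_edge_relation: "e \<in> arcs G \<Longrightarrow> vtx (tail G e) * edge e - edge e \<in> leavitt_ideal G"
  by (rule relation_in_ideal) (unfold leavitt_relations_def, blast)

lemma edge_head_relation: "e \<in> arcs G \<Longrightarrow> edge e * vtx (head G e) - edge e \<in> leavitt_ideal G"
  by (rule relation_in_ideal) (unfold leavitt_relations_def, blast)

lemma head_ghost_relation: "e \<in> arcs G \<Longrightarrow> vtx (head G e) * ghost e - ghost e \<in> leavitt_ideal G"
  by (rule relation_in_ideal) (unfold leavitt_relations_def, blast)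

lemma ghost_tail_relation: "e \<in> arcs G \<Longrightarrow> ghost e * vtx (tail G e) - ghost e \<in> leavitt_ideal G"
  by (rule relation_in_ideal) (unfold leavitt_relations_def, blast)

lemma ghost_edge_relation:
  "e \<in> arcs G \<Longrightarrow> f \<in> arcs G \<Longrightarrow> ghost e * edge f - (if e = f then vtx (head G e) else 0) \<in> leavitt_ideal G"
  by (rule relation_in_ideal) (unfold leavitt_relations_def, blast)

lemma sum_vertices_nonunital: "(\<Sum>v\<in>verts G. vtx v) \<in> nonunital_part G"
  by (intro nonunital_sum nonunital_single) auto

lemma sum_vertices_mult_vertex:
  fixes u :: "('a, 'b, 'k::field) path_poly"
  assumes "w \<in> verts G" and u: "u = (\<Sum>v\<in>verts G. vtx v)"
  shows "u * vtx w - vtx w \<in> leavitt_ideal G"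
    and "vtx w * u - vtx w \<in> leavitt_ideal G"
proof -
  have "u * vtx w - vtx w = (\<Sum>v\<in>verts G. vtx v * vtx w - (if v = w then vtx w else 0))"
    using assms(1) by (simp add: u sum_subtractf sum_distrib_right)
  moreover have "(\<Sum>v\<in>verts G. vtx v * vtx w - (if v = w then vtx w else 0) :: ('a, 'b, 'k) path_poly) \<in> leavitt_ideal G"
    by (intro leavitt_ideal_sum vertex_relation assms(1))
  ultimately show "u * vtx w - vtx w \<in> leavitt_ideal G" by (simp only:)
  have "vtx w * u - vtx w = (\<Sum>v\<in>verts G. vtx w * vtx v - (if w = v then vtx v else 0))"
    using assms(1) by (simp add: u sum_subtractf sum_distrib_left)
  moreover have "(\<Sum>v\<in>verts G. vtx w * vtx v - (if w = v then vtx v else 0) :: ('a, 'b, 'k) path_poly) \<in> leavitt_ideal G"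
    by (intro leavitt_ideal_sum vertex_relation assms(1))
  ultimately show "vtx w * u - vtx w \<in> leavitt_ideal G" by (simp only:)
qed

text \<open>
  Modulo the ideal, \<open>x = t x = u t x = u x\<close>. In the next lemmas \<open>u\<close> is the sum of all vertices and
  \<open>t\<close> the vertex at which the letter \<open>x\<close> starts or, in the mirrored version, ends.
\<close>

lemma left_unit_transfer:
  assumes "u * t - t \<in> leavitt_ideal G" "t * x - x \<in> leavitt_ideal G"
    and "u \<in> carrier (free_algebra G)" "x \<in> carrier (free_algebra G)"
  shows "u * x - x \<in> leavitt_ideal G"
proof -
  have "u * x - x = (u * t - t) * x + (t * x - x) - u * (t * x - x)"
    by (simp add: algebra_simps)
  then show ?thesis
    by (simp only: assms leavitt_ideal_add leavitt_ideal_diff leavitt_ideal_mult_left leavitt_ideal_mult_right)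
qed

lemma right_unit_transfer:
  assumes "t * u - t \<in> leavitt_ideal G" "x * t - x \<in> leavitt_ideal G"
    and "u \<in> carrier (free_algebra G)" "x \<in> carrier (free_algebra G)"
  shows "x * u - x \<in> leavitt_ideal G"
proof -
  have "x * u - x = x * (t * u - t) + (x * t - x) - (x * t - x) * u"
    by (simp add: algebra_simps)
  then show ?thesis
    by (simp only: assms leavitt_ideal_add leavitt_ideal_diff leavitt_ideal_mult_left leavitt_ideal_mult_right)
qed

lemma sum_vertices_mult_letter:
  fixes l :: "('a, 'b) letter"
  assumes "l \<in> graph_letters G"
  defines "x \<equiv> Poly_Mapping.single (Word [l]) (1 :: 'k::field)"
  shows "(\<Sum>v\<in>verts G. vtx v) * x - x \<in> leavitt_ideal G"
    and "x * (\<Sum>v\<in>verts G. vtx v) - x \<in> leavitt_ideal G"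
proof -
  note u = nonunital_in_carrier[OF sum_vertices_nonunital]
  have x: "x \<in> carrier (free_algebra G)" unfolding x_def using assms(1) by (rule letter_in_free_algebra)
  show "(\<Sum>v\<in>verts G. vtx v) * x - x \<in> leavitt_ideal G"
  proof (cases l)
    case (Vertex w)
    then show ?thesis using assms sum_vertices_mult_vertex(1)[OF _ refl] by simp
  next
    case (Edge e)
    then show ?thesis
      using assms(1) by (intro left_unit_transfer[OF sum_vertices_mult_vertex(1)[OF _ refl] _ u x, of "tail G e"])
        (simp_all add: x_def tail_edge_relation)
  next
    case (Ghost e)
    then show ?thesis
      using assms(1) by (intro left_unit_transfer[OF sum_vertices_mult_vertex(1)[OF _ refl] _ u x, of "head G e"])
        (simp_all add: x_def head_ghost_relation)
  qed
  show "x * (\<Sum>v\<in>verts G. vtx v) - x \<in> leavitt_ideal G"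
  proof (cases l)
    case (Vertex w)
    then show ?thesis using assms sum_vertices_mult_vertex(2)[OF _ refl] by simp
  next
    case (Edge e)
    then show ?thesis
      using assms(1) by (intro right_unit_transfer[OF sum_vertices_mult_vertex(2)[OF _ refl] _ u x, of "head G e"])
        (simp_all add: x_def edge_head_relation)
  next
    case (Ghost e)
    then show ?thesis
      using assms(1) by (intro right_unit_transfer[OF sum_vertices_mult_vertex(2)[OF _ refl] _ u x, of "tail G e"])
        (simp_all add: x_def ghost_tail_relation)
  qed
qed

text \<open>
  Multiplication by the sum of the vertices only concerns the first or the last letter of a word, which
  exists because the constant term is excluded.
\<close>

lemma sum_vertices_unit:
  fixes x :: "('a, 'b, 'k::field) path_poly"
  assumes "x \<in> nonunital_part G"
  shows "(\<Sum>v\<in>verts G. vtx v) * x - x \<in> leavitt_ideal G"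
    and "x * (\<Sum>v\<in>verts G. vtx v) - x \<in> leavitt_ideal G"
proof -
  let ?u = "\<Sum>v\<in>verts G. vtx v :: ('a, 'b, 'k) path_poly"
  have word: "?u * Poly_Mapping.single w c - Poly_Mapping.single w c \<in> leavitt_ideal G \<and>
      Poly_Mapping.single w c * ?u - Poly_Mapping.single w c \<in> leavitt_ideal G"
    if "w \<in> Poly_Mapping.keys x" for w and c :: 'k
  proof
    have w: "set (letters w) \<subseteq> graph_letters G" "letters w \<noteq> []"
      using assms that by (auto simp: nonunital_part_iff)
    show "?u * Poly_Mapping.single w c - Poly_Mapping.single w c \<in> leavitt_ideal G"
    proof -
      obtain l ws where l: "letters w = l # ws" using w(2) by (cases "letters w") auto
      let ?l = "Poly_Mapping.single (Word [l]) 1" and ?y = "Poly_Mapping.single (Word ws) c"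
      have "w = Word [l] + Word ws" by (metis l append_Cons append_Nil plus_word_def word.sel word.exhaust_sel)
      then have "?u * Poly_Mapping.single w c - Poly_Mapping.single w c = (?u * ?l - ?l) * ?y"
        by (simp add: mult_single left_diff_distrib mult.assoc)
      moreover have "?y \<in> carrier (free_algebra G)" "l \<in> graph_letters G"
        using w l by (simp_all add: free_algebra_carrier_iff)
      ultimately show ?thesis
        by (simp only: leavitt_ideal_mult_right sum_vertices_mult_letter(1))
    qed
    show "Poly_Mapping.single w c * ?u - Poly_Mapping.single w c \<in> leavitt_ideal G"
    proof -
      obtain ws l where l: "letters w = ws @ [l]" using w(2) by (cases "letters w" rule: rev_cases) auto
      let ?l = "Poly_Mapping.single (Word [l]) 1" and ?y = "Poly_Mapping.single (Word ws) c"
      have "w = Word ws + Word [l]" by (metis l plus_word_def word.sel word.exhaust_sel)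
      then have "Poly_Mapping.single w c * ?u - Poly_Mapping.single w c = ?y * (?l * ?u - ?l)"
        by (simp add: mult_single right_diff_distrib flip: mult.assoc)
      moreover have "?y \<in> carrier (free_algebra G)" "l \<in> graph_letters G"
        using w l by (simp_all add: free_algebra_carrier_iff)
      ultimately show ?thesis
        by (simp only: leavitt_ideal_mult_left sum_vertices_mult_letter(2))
    qed
  qed
  show "?u * x - x \<in> leavitt_ideal G"
  proof (rule poly_mapping_span_induct[where P = "\<lambda>x. ?u * x - x \<in> leavitt_ideal G" and p = x])
    fix y z :: "('a, 'b, 'k) path_poly"
    assume "?u * y - y \<in> leavitt_ideal G" "?u * z - z \<in> leavitt_ideal G"
    from leavitt_ideal_add[OF this] show "?u * (y + z) - (y + z) \<in> leavitt_ideal G"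
      by (simp add: distrib_left add_diff_add)
  qed (simp_all add: leavitt_ideal_zero word)
  show "x * ?u - x \<in> leavitt_ideal G"
  proof (rule poly_mapping_span_induct[where P = "\<lambda>x. x * ?u - x \<in> leavitt_ideal G" and p = x])
    fix y z :: "('a, 'b, 'k) path_poly"
    assume "y * ?u - y \<in> leavitt_ideal G" "z * ?u - z \<in> leavitt_ideal G"
    from leavitt_ideal_add[OF this] show "(y + z) * ?u - (y + z) \<in> leavitt_ideal G"
      by (simp add: distrib_right add_diff_add)
  qed (simp_all add: leavitt_ideal_zero word)
qed

lemma ring_leavitt: "ring (leavitt_path_algebra G :: ('a, 'b, 'k::field) path_poly set ring)"
proof (rule ringI)
  let ?L = "leavitt_path_algebra G :: ('a, 'b, 'k::field) path_poly set ring"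
  note closed = nonunital_zero nonunital_add nonunital_mult nonunital_uminus sum_vertices_nonunital
  show "abelian_group ?L"
  proof (rule abelian_groupI)
    show "\<exists>y\<in>carrier ?L. y \<oplus>\<^bsub>?L\<^esub> x = \<zero>\<^bsub>?L\<^esub>" if x: "x \<in> carrier ?L" for x
    proof -
      obtain p where p: "x = leavitt_class G p" "p \<in> nonunital_part G" using x by (auto simp: leavitt_simps)
      then show ?thesis
        using closed(4)[of p] by (intro bexI[of _ "leavitt_class G (- p)"]) (auto simp: leavitt_simps)
    qed
  qed (auto simp: leavitt_simps closed add_ac)
  show "monoid ?L"
  proof (rule monoidI)
    show "\<one>\<^bsub>?L\<^esub> \<otimes>\<^bsub>?L\<^esub> x = x" if x: "x \<in> carrier ?L" for x
    proof -
      obtain p where p: "x = leavitt_class G p" "p \<in> nonunital_part G" using x by (auto simp: leavitt_simps)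
      then have "(\<Sum>v\<in>verts G. vtx v) * p - p \<in> leavitt_ideal G" by (intro sum_vertices_unit)
      then have "leavitt_class G ((\<Sum>v\<in>verts G. vtx v) * p) = leavitt_class G p"
        using p by (subst leavitt_class_eq_iff) (auto intro!: nonunital_in_carrier closed)
      then show ?thesis using p by (simp add: leavitt_simps closed)
    qed
    show "x \<otimes>\<^bsub>?L\<^esub> \<one>\<^bsub>?L\<^esub> = x" if x: "x \<in> carrier ?L" for x
    proof -
      obtain p where p: "x = leavitt_class G p" "p \<in> nonunital_part G" using x by (auto simp: leavitt_simps)
      then have "p * (\<Sum>v\<in>verts G. vtx v) - p \<in> leavitt_ideal G" by (intro sum_vertices_unit)
      then have "leavitt_class G (p * (\<Sum>v\<in>verts G. vtx v)) = leavitt_class G p"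
        using p by (subst leavitt_class_eq_iff) (auto intro!: nonunital_in_carrier closed)
      then show ?thesis using p by (simp add: leavitt_simps closed)
    qed
  qed (auto simp: leavitt_simps closed mult.assoc)
qed (auto simp: leavitt_simps nonunital_add nonunital_mult distrib_left distrib_right)

lemma finsum_leavitt:
  fixes g :: "'t \<Rightarrow> ('a, 'b, 'k::field) path_poly"
  assumes "\<And>t. t \<in> F \<Longrightarrow> g t \<in> nonunital_part G"
  shows "(\<Oplus>\<^bsub>leavitt_path_algebra G\<^esub>t\<in>F. leavitt_class G (g t)) = leavitt_class G (\<Sum>t\<in>F. g t)"
proof -
  interpret L: ring "leavitt_path_algebra G :: ('a, 'b, 'k) path_poly set ring" by (rule ring_leavitt)
  show ?thesis
    using assms
  proof (induction F rule: infinite_finite_induct)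
    case (insert t F)
    then have "(\<Oplus>\<^bsub>leavitt_path_algebra G\<^esub>t\<in>insert t F. leavitt_class G (g t)) =
        leavitt_class G (g t) \<oplus>\<^bsub>leavitt_path_algebra G\<^esub> (\<Oplus>\<^bsub>leavitt_path_algebra G\<^esub>t\<in>F. leavitt_class G (g t))"
      by (intro L.finsum_insert) (auto simp: leavitt_carrier)
    then show ?case using insert by (simp add: leavitt_add nonunital_sum)
  qed (simp_all add: leavitt_zero)
qed

abbreviation homogeneous :: "int \<Rightarrow> ('a, 'b, 'k::field) path_poly set"
  where "homogeneous n \<equiv> {p \<in> nonunital_part G. \<forall>w\<in>Poly_Mapping.keys p. word_degree w = n}"

lemma homogeneous_closed:
  fixes p q :: "('a, 'b, 'k::field) path_poly"
  shows "0 \<in> (homogeneous n :: ('a, 'b, 'k) path_poly set)"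
    and "p \<in> homogeneous n \<Longrightarrow> - p \<in> homogeneous n"
    and "p \<in> homogeneous n \<Longrightarrow> q \<in> homogeneous n \<Longrightarrow> p + q \<in> homogeneous n"
    and "p \<in> homogeneous m \<Longrightarrow> q \<in> homogeneous n \<Longrightarrow> p * q \<in> homogeneous (m + n)"
    and "p \<in> nonunital_part G \<Longrightarrow> homogeneous_part n p \<in> homogeneous n"
  using Poly_Mapping.keys_add[of p q] Poly_Mapping.keys_mult[of p q]
  by (auto simp: nonunital_zero nonunital_uminus nonunital_add nonunital_mult word_degree_add
      keys_homogeneous_part nonunital_part_iff[of "homogeneous_part n p"] dest!: subsetD)
    (auto simp: nonunital_part_iff)

lemma leavitt_grading_decomposition:
  fixes p :: "('a, 'b, 'k::field) path_poly"
  assumes p: "p \<in> nonunital_part G"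
  shows "leavitt_class G p = (\<Oplus>\<^bsub>leavitt_path_algebra G\<^esub>n\<in>word_degree ` Poly_Mapping.keys p.
    leavitt_class G (homogeneous_part n p))"
  using homogeneous_closed(5)[OF p] by (subst finsum_leavitt) (auto simp: sum_homogeneous_parts)

text \<open>
  The components of the class of \<open>p\<close> are the classes of the homogeneous parts of \<open>p\<close>. Any other family
  of homogeneous elements with the same sum is represented by homogeneous polynomials \<open>q \<gamma>\<close> whose sum
  differs from \<open>p\<close> by an element of the ideal. Its homogeneous part of degree \<open>\<gamma>\<close> is again in the ideal.
\<close>

lemma graded_ring_leavitt:
  "graded_ring (leavitt_path_algebra G :: ('a, 'b, 'k::field) path_poly set ring) (leavitt_grading G)"
proof (rule graded_ring.intro[OF ring_leavitt graded_ring_axioms.intro])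
  let ?L = "leavitt_path_algebra G :: ('a, 'b, 'k::field) path_poly set ring"
  interpret L: ring ?L by (rule ring_leavitt)
  fix \<gamma> \<delta> :: int
  show "additive_subgroup (leavitt_grading G \<gamma>) ?L"
  proof (rule additive_subgroup.intro, rule L.add.subgroupI)
    fix x :: "('a, 'b, 'k) path_poly set"
    assume x: "x \<in> leavitt_grading G \<gamma>"
    then obtain p where p: "x = leavitt_class G p" "p \<in> homogeneous \<gamma>" by (auto simp: leavitt_grading_def)
    have "\<ominus>\<^bsub>?L\<^esub> x = leavitt_class G (- p)"
      using p nonunital_uminus[of p] by (intro L.minus_equality) (auto simp: leavitt_simps)
    then show "\<ominus>\<^bsub>?L\<^esub> x \<in> leavitt_grading G \<gamma>"
      unfolding leavitt_grading_def using homogeneous_closed(2)[OF p(2)] by blast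
    fix y :: "('a, 'b, 'k) path_poly set"
    assume "y \<in> leavitt_grading G \<gamma>"
    then obtain q where q: "y = leavitt_class G q" "q \<in> homogeneous \<gamma>" by (auto simp: leavitt_grading_def)
    have "x \<oplus>\<^bsub>?L\<^esub> y = leavitt_class G (p + q)" using p q by (simp add: leavitt_add)
    then show "x \<oplus>\<^bsub>?L\<^esub> y \<in> leavitt_grading G \<gamma>"
      unfolding leavitt_grading_def using homogeneous_closed(3)[OF p(2) q(2)] by blast
  next
    show "leavitt_grading G \<gamma> \<noteq> ({} :: ('a, 'b, 'k) path_poly set set)"
      using homogeneous_closed(1) unfolding leavitt_grading_def by blast
  qed (auto simp: leavitt_grading_def leavitt_carrier)
next
  let ?L = "leavitt_path_algebra G :: ('a, 'b, 'k::field) path_poly set ring"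
  fix \<gamma> \<delta> :: int and x y :: "('a, 'b, 'k) path_poly set"
  assume x: "x \<in> leavitt_grading G \<gamma>" and y: "y \<in> leavitt_grading G \<delta>"
  show "x \<otimes>\<^bsub>?L\<^esub> y \<in> leavitt_grading G (\<gamma> + \<delta>)"
  proof -
    obtain p where p: "x = leavitt_class G p" "p \<in> homogeneous \<gamma>" using x by (auto simp: leavitt_grading_def)
    obtain q where q: "y = leavitt_class G q" "q \<in> homogeneous \<delta>" using y by (auto simp: leavitt_grading_def)
    have "x \<otimes>\<^bsub>?L\<^esub> y = leavitt_class G (p * q)" using p q by (simp add: leavitt_mult)
    then show ?thesis
      unfolding leavitt_grading_def using homogeneous_closed(4)[OF p(2) q(2)] by blast
  qed
next
  let ?L = "leavitt_path_algebra G :: ('a, 'b, 'k::field) path_poly set ring"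
  interpret L: ring ?L by (rule ring_leavitt)
  fix x
  assume "x \<in> carrier ?L"
  then obtain p where p: "x = leavitt_class G p" "p \<in> nonunital_part G" by (auto simp: leavitt_carrier)
  let ?P = "\<lambda>c. (\<forall>\<gamma>. c \<gamma> \<in> leavitt_grading G \<gamma>) \<and> finite {\<gamma>. c \<gamma> \<noteq> \<zero>\<^bsub>?L\<^esub>} \<and>
    x = (\<Oplus>\<^bsub>?L\<^esub>\<gamma>\<in>{\<gamma>. c \<gamma> \<noteq> \<zero>\<^bsub>?L\<^esub>}. c \<gamma>)"
  let ?c = "\<lambda>\<gamma>. leavitt_class G (homogeneous_part \<gamma> p)"
  show "\<exists>!c. ?P c"
  proof
    have supp: "{\<gamma>. ?c \<gamma> \<noteq> \<zero>\<^bsub>?L\<^esub>} \<subseteq> word_degree ` Poly_Mapping.keys p"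
    proof
      fix \<gamma> assume "\<gamma> \<in> {\<gamma>. ?c \<gamma> \<noteq> \<zero>\<^bsub>?L\<^esub>}"
      then have "homogeneous_part \<gamma> p \<noteq> 0" by (auto simp: leavitt_zero)
      then have "Poly_Mapping.keys (homogeneous_part \<gamma> p) \<noteq> {}" by simp
      then show "\<gamma> \<in> word_degree ` Poly_Mapping.keys p" by (auto simp: keys_homogeneous_part)
    qed
    have cL: "?c \<gamma> \<in> carrier ?L" for \<gamma>
      using homogeneous_closed(5)[OF p(2), of \<gamma>] by (simp add: leavitt_carrier)
    have "x = (\<Oplus>\<^bsub>?L\<^esub>\<gamma>\<in>{\<gamma>. ?c \<gamma> \<noteq> \<zero>\<^bsub>?L\<^esub>}. ?c \<gamma>)"
      unfolding p(1) leavitt_grading_decomposition[OF p(2)]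
      using supp cL by (intro L.add.finprod_mono_neutral_cong_right) auto
    then show "?P ?c"
      using homogeneous_closed(5)[OF p(2)] finite_subset[OF supp]
      by (auto simp: leavitt_grading_def)
  next
    fix c
    assume c: "?P c"
    let ?S = "{\<gamma>. c \<gamma> \<noteq> \<zero>\<^bsub>?L\<^esub>}"
    have "\<exists>q. q \<in> homogeneous \<gamma> \<and> c \<gamma> = leavitt_class G q" for \<gamma>
      using c[THEN conjunct1, rule_format, of \<gamma>] unfolding leavitt_grading_def by blast
    then have "\<exists>q. \<forall>\<gamma>. q \<gamma> \<in> homogeneous \<gamma> \<and> c \<gamma> = leavitt_class G (q \<gamma>)"
      by (intro choice allI)
    then obtain q where q: "\<forall>\<gamma>. q \<gamma> \<in> homogeneous \<gamma> \<and> c \<gamma> = leavitt_class G (q \<gamma>)"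
      by (rule exE)
    note q = q[rule_format, THEN conjunct1] q[rule_format, THEN conjunct2]
    have qN: "q \<gamma> \<in> nonunital_part G" for \<gamma> using q(1) by blast
    have "leavitt_class G p = leavitt_class G (\<Sum>\<gamma>\<in>?S. q \<gamma>)"
      using c p finsum_leavitt[of ?S q] qN by (simp add: q(2))
    then have diff: "p - (\<Sum>\<gamma>\<in>?S. q \<gamma>) \<in> leavitt_ideal G"
      using p qN by (simp add: leavitt_class_eq_iff nonunital_in_carrier nonunital_sum)
    show "c = ?c"
    proof
      fix \<gamma>
      have "homogeneous_part \<gamma> (q \<delta>) = (if \<delta> = \<gamma> then q \<delta> else 0)" for \<delta>
        using q(1)[of \<delta>] by (subst homogeneous_part_of_homogeneous[of _ \<delta>]) auto
      then have "homogeneous_part \<gamma> (\<Sum>\<gamma>\<in>?S. q \<gamma>) = (if \<gamma> \<in> ?S then q \<gamma> else 0)"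
        using c by (simp add: homogeneous_part_sum)
      then have "homogeneous_part \<gamma> p - (if \<gamma> \<in> ?S then q \<gamma> else 0) \<in> leavitt_ideal G"
        using leavitt_ideal_homogeneous_part[OF diff, of \<gamma>] by (simp add: homogeneous_part_diff)
      then have "leavitt_class G (homogeneous_part \<gamma> p) = leavitt_class G (if \<gamma> \<in> ?S then q \<gamma> else 0)"
        using homogeneous_closed(5)[OF p(2), of \<gamma>] qN
        by (subst leavitt_class_eq_iff) (auto simp: nonunital_in_carrier nonunital_zero)
      also have "\<dots> = c \<gamma>" using q(2)[of \<gamma>] by (auto simp: leavitt_zero)
      finally show "c \<gamma> = ?c \<gamma>" by simp
    qed
  qed
qed

end

section \<open>The representation on functions on paths\<close>

context fin_digraph
begin

text \<open>
  A path that ends at \<open>s\<close> is given by its list of edges. The empty list is the trivial path at \<open>s\<close>.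
\<close>

fun path_start :: "'a \<Rightarrow> 'b list \<Rightarrow> 'a"
  where
    "path_start s [] = s"
  | "path_start s (e # p) = tail G e"

fun path_to :: "'a \<Rightarrow> 'b list \<Rightarrow> bool"
  where
    "path_to s [] \<longleftrightarrow> True"
  | "path_to s (e # p) \<longleftrightarrow> e \<in> arcs G \<and> head G e = path_start s p \<and> path_to s p"

text \<open>
  On indicator functions of paths into \<open>s\<close> this is left multiplication: a vertex keeps the paths that
  start there, an edge is prepended where possible, and a ghost edge \<open>e\<close> removes a leading \<open>e\<close> and
  annihilates all other paths. Functions are arbitrary on lists that are not paths; the conditions on
  \<open>path_to\<close> ensure that letters only produce functions that vanish there.
\<close>

fun letter_action :: "'a \<Rightarrow> ('a, 'b) letter \<Rightarrow> ('b list \<Rightarrow> 'k::field) \<Rightarrow> 'b list \<Rightarrow> 'k"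
  where
    "letter_action s (Vertex u) f p = (if path_to s p \<and> path_start s p = u then f p else 0)"
  | "letter_action s (Edge e) f p =
      (case p of [] \<Rightarrow> 0 | e' # q \<Rightarrow> if e' = e \<and> path_to s p then f q else 0)"
  | "letter_action s (Ghost e) f p = (if path_to s (e # p) then f (e # p) else 0)"

definition word_action :: "'a \<Rightarrow> ('a, 'b) word \<Rightarrow> ('b list \<Rightarrow> 'k::field) \<Rightarrow> 'b list \<Rightarrow> 'k"
  where "word_action s w f = foldr (letter_action s) (letters w) f"

definition poly_action :: "'a \<Rightarrow> ('a, 'b, 'k::field) path_poly \<Rightarrow> ('b list \<Rightarrow> 'k) \<Rightarrow> 'b list \<Rightarrow> 'k"
  where "poly_action s x f p = (\<Sum>w\<in>Poly_Mapping.keys x. Poly_Mapping.lookup x w * word_action s w f p)"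

lemma letter_action_linear:
  "letter_action s l (\<lambda>p. c * f p + g p) p = c * letter_action s l f p + letter_action s l g p"
  by (cases l; cases p) auto

lemma foldr_letter_action_linear:
  "foldr (letter_action s) ls (\<lambda>p. c * f p + g p) =
    (\<lambda>p. c * foldr (letter_action s) ls f p + foldr (letter_action s) ls g p)"
proof (induction ls)
  case (Cons l ls)
  then show ?case by (auto simp: letter_action_linear)
qed simp

lemma word_action_linear:
  "word_action s w (\<lambda>p. c * f p + g p) p = c * word_action s w f p + word_action s w g p"
  by (simp add: word_action_def foldr_letter_action_linear)

lemma word_action_zero: "word_action s w (\<lambda>_. 0) p = 0"
  using word_action_linear[of s w "- 1" "\<lambda>_. 0" "\<lambda>_. 0" p] by simp

lemma word_action_scale: "word_action s w (\<lambda>p. c * f p) p = c * word_action s w f p"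
  using word_action_linear[of s w c f "\<lambda>_. 0" p] by (simp add: word_action_zero)

lemma word_action_plus: "word_action s w (\<lambda>p. f p + g p) p = word_action s w f p + word_action s w g p"
  using word_action_linear[of s w 1 f g p] by simp

lemma word_action_concat: "word_action s (v + w) f = word_action s v (word_action s w f)"
  by (simp add: word_action_def)

lemma poly_action_superset:
  assumes "finite W" "Poly_Mapping.keys x \<subseteq> W"
  shows "poly_action s x f p = (\<Sum>w\<in>W. Poly_Mapping.lookup x w * word_action s w f p)"
  unfolding poly_action_def using assms by (intro sum.mono_neutral_left) (auto simp: in_keys_iff)

lemma poly_action_single: "poly_action s (Poly_Mapping.single w c) f p = c * word_action s w f p"
  by (simp add: poly_action_superset[of "{w}"])

lemma poly_action_zero: "poly_action s 0 f p = 0"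
  by (simp add: poly_action_def)

lemma poly_action_add: "poly_action s (x + y) f p = poly_action s x f p + poly_action s y f p"
proof -
  let ?W = "Poly_Mapping.keys x \<union> Poly_Mapping.keys y"
  have "poly_action s (x + y) f p = (\<Sum>w\<in>?W. Poly_Mapping.lookup (x + y) w * word_action s w f p)"
    by (intro poly_action_superset Poly_Mapping.keys_add) simp
  then show ?thesis
    by (simp add: poly_action_superset[of ?W x] poly_action_superset[of ?W y] lookup_add distrib_right sum.distrib)
qed

lemma poly_action_uminus: "poly_action s (- x) f p = - poly_action s x f p"
  by (simp add: poly_action_def sum_negf)

lemma poly_action_diff: "poly_action s (x - y) f p = poly_action s x f p - poly_action s y f p"
  using poly_action_add[of s x "- y" f p] by (simp add: poly_action_uminus)

lemma poly_action_sum: "poly_action s (\<Sum>t\<in>F. x t) f p = (\<Sum>t\<in>F. poly_action s (x t) f p)"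
  by (induction F rule: infinite_finite_induct) (simp_all add: poly_action_zero poly_action_add)

lemma poly_action_zero_vec: "poly_action s x (\<lambda>_. 0) p = 0"
  by (simp add: poly_action_def word_action_zero)

lemma poly_action_scale: "poly_action s x (\<lambda>p. c * f p) p = c * poly_action s x f p"
  by (simp add: poly_action_def word_action_scale sum_distrib_left mult.left_commute)

lemma poly_action_plus: "poly_action s x (\<lambda>p. f p + g p) p = poly_action s x f p + poly_action s x g p"
  by (simp add: poly_action_def word_action_plus distrib_left sum.distrib)

lemma poly_action_mult:
  fixes x y :: "('a, 'b, 'k::field) path_poly"
  shows "poly_action s (x * y) f p = poly_action s x (poly_action s y f) p"
proof -
  have single: "poly_action s (Poly_Mapping.single w c * y) f p =
      poly_action s (Poly_Mapping.single w c) (poly_action s y f) p" for w and c :: 'k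
  proof (rule poly_mapping_span_induct[where p = y])
    show "poly_action s (Poly_Mapping.single w c * 0) f p =
        poly_action s (Poly_Mapping.single w c) (poly_action s 0 f) p"
      by (simp add: poly_action_zero poly_action_zero[abs_def] poly_action_zero_vec)
  next
    fix v
    have "poly_action s (Poly_Mapping.single v (Poly_Mapping.lookup y v)) f =
        (\<lambda>p. Poly_Mapping.lookup y v * word_action s v f p)"
      by (simp add: fun_eq_iff poly_action_single)
    then show "poly_action s (Poly_Mapping.single w c * Poly_Mapping.single v (Poly_Mapping.lookup y v)) f p =
        poly_action s (Poly_Mapping.single w c)
          (poly_action s (Poly_Mapping.single v (Poly_Mapping.lookup y v)) f) p"
      by (simp add: mult_single poly_action_single word_action_concat word_action_scale mult_ac)
  next
    fix y z :: "('a, 'b, 'k) path_poly"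
    assume "poly_action s (Poly_Mapping.single w c * y) f p =
        poly_action s (Poly_Mapping.single w c) (poly_action s y f) p"
      and "poly_action s (Poly_Mapping.single w c * z) f p =
        poly_action s (Poly_Mapping.single w c) (poly_action s z f) p"
    moreover have "poly_action s (y + z) f = (\<lambda>p. poly_action s y f p + poly_action s z f p)"
      by (simp add: fun_eq_iff poly_action_add)
    ultimately show "poly_action s (Poly_Mapping.single w c * (y + z)) f p =
        poly_action s (Poly_Mapping.single w c) (poly_action s (y + z) f) p"
      by (simp add: distrib_left poly_action_add poly_action_plus)
  qed
  show ?thesis
    by (rule poly_mapping_span_induct[where p = x])
      (simp_all add: poly_action_zero single distrib_right poly_action_add)
qed

lemma path_start_in_verts: "s \<in> verts G \<Longrightarrow> path_to s p \<Longrightarrow> path_start s p \<in> verts G"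
  by (cases p) auto

lemma sink_not_tail: "sink G s \<Longrightarrow> e \<in> arcs G \<Longrightarrow> tail G e \<noteq> s"
  by (auto simp: sink_def out_arcs_def)

text \<open>
  A nontrivial path starting at \<open>v\<close> has exactly one edge at its beginning, which leaves \<open>v\<close>. The trivial
  path starts at the sink, so not at the regular vertex \<open>v\<close>.
\<close>

lemma vertex_action_eq_sum_out_arcs:
  assumes "sink G s" "regular G v"
  shows "(\<Sum>e\<in>out_arcs G v. letter_action s (Edge e) (letter_action s (Ghost e) f) p) =
    letter_action s (Vertex v) f p"
proof (cases p)
  case Nil
  then show ?thesis using assms by (auto simp: sink_def regular_def)
next
  case (Cons e q)
  have "(\<Sum>e'\<in>out_arcs G v. letter_action s (Edge e') (letter_action s (Ghost e') f) p) =
      (\<Sum>e'\<in>out_arcs G v. if e' = e then (if path_to s p then f p else 0) else 0)"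
    by (intro sum.cong) (auto simp: Cons)
  also have "\<dots> = (if e \<in> out_arcs G v \<and> path_to s p then f p else 0)"
    using assms(2) by (simp add: regular_def)
  also have "\<dots> = letter_action s (Vertex v) f p"
    by (auto simp: Cons)
  finally show ?thesis .
qed

lemma leavitt_relation_acts_trivially:
  fixes r :: "('a, 'b, 'k::field) path_poly"
  assumes "sink G s" "r \<in> leavitt_relations G"
  shows "poly_action s r f p = 0"
proof -
  note act = poly_action_diff poly_action_sum poly_action_zero mult_single poly_action_single word_action_def
  consider (vv) v w where "r = vtx v * vtx w - (if v = w then vtx w else 0)"
    | (te) e where "r = vtx (tail G e) * edge e - edge e"
    | (eh) e where "r = edge e * vtx (head G e) - edge e"
    | (hg) e where "r = vtx (head G e) * ghost e - ghost e"
    | (gt) e where "r = ghost e * vtx (tail G e) - ghost e"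
    | (ge) e f where "r = ghost e * edge f - (if e = f then vtx (head G e) else 0)" "e \<in> arcs G"
    | (CK2) v where "r = vtx v - (\<Sum>e\<in>out_arcs G v. edge e * ghost e)" "regular G v"
    using assms(2) unfolding leavitt_relations_def by blast
  then show ?thesis
  proof cases
    case vv then show ?thesis by (auto simp: act)
  next
    case te then show ?thesis by (auto simp: act split: list.splits)
  next
    case eh then show ?thesis by (auto simp: act split: list.splits)
  next
    case hg then show ?thesis by (auto simp: act)
  next
    case gt then show ?thesis by (auto simp: act)
  next
    case ge then show ?thesis by (auto simp: act)
  next
    case (CK2 v)
    then show ?thesis using vertex_action_eq_sum_out_arcs[OF assms(1), of v f p] by (simp add: act del: letter_action.simps)
  qed
qed

text \<open>
  The polynomials that act as zero form an ideal, because the action is multiplicative.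
\<close>

lemma leavitt_ideal_acts_trivially:
  fixes x :: "('a, 'b, 'k::field) path_poly"
  assumes "sink G s" "x \<in> leavitt_ideal G"
  shows "poly_action s x f p = 0"
proof -
  define J :: "('a, 'b, 'k) path_poly set"
    where "J = {x \<in> carrier (free_algebra G). \<forall>f p. poly_action s x f p = 0}"
  have "ideal J (free_algebra G)"
  proof (rule ideal_free_algebraI)
    interpret A: ring "free_algebra G :: ('a, 'b, 'k) path_poly ring" by (rule ring_free_algebra)
    have closed: "Poly_Mapping.single w c \<in> carrier (free_algebra G)"
      if "set (letters w) \<subseteq> graph_letters G" for w and c :: 'k
      using that by (simp add: free_algebra_carrier_iff)
    show "0 \<in> J" by (simp add: J_def free_algebra_carrier_iff poly_action_zero)
    show "x + y \<in> J" if "x \<in> J" "y \<in> J" for x y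
      using that A.add.m_closed[of x y] by (simp add: J_def poly_action_add free_algebra_simps)
    show "Poly_Mapping.single w c * x \<in> J" if "x \<in> J" "set (letters w) \<subseteq> graph_letters G" for w c x
    proof -
      have "poly_action s x f = (\<lambda>_. 0)" for f using that by (simp add: J_def fun_eq_iff)
      then show ?thesis
        using that A.m_closed[OF closed, of w x c]
        by (simp add: J_def poly_action_mult poly_action_zero_vec free_algebra_simps)
    qed
    show "x * Poly_Mapping.single w c \<in> J" if "x \<in> J" "set (letters w) \<subseteq> graph_letters G" for w c x
      using that A.m_closed[OF _ closed, of x w c]
      by (simp add: J_def poly_action_mult free_algebra_simps)
  qed (auto simp: J_def)
  moreover have "leavitt_relations G \<subseteq> J"
    using leavitt_relations_nonunital nonunital_in_carrier leavitt_relation_acts_trivially[OF assms(1)]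
    by (auto simp: J_def)
  ultimately have "leavitt_ideal G \<subseteq> J" by (rule leavitt_ideal_minimal)
  then show ?thesis using assms(2) by (auto simp: J_def)
qed

end

section \<open>Reduction of words to paths into a sink\<close>

context fin_digraph
begin

text \<open>
  The vertex \<open>s\<close> at the end represents the trivial path and makes the monomial an element of \<open>R s\<close>.
\<close>

definition path_monomial :: "'a \<Rightarrow> 'b list \<Rightarrow> ('a, 'b, 'k::field) path_poly"
  where "path_monomial s p = Poly_Mapping.single (Word (map Edge p @ [Vertex s])) 1"

lemma path_monomial_Nil: "path_monomial s [] = vtx s"
  by (simp add: path_monomial_def)

lemma path_monomial_Cons: "path_monomial s (e # p) = edge e * path_monomial s p"
  by (simp add: path_monomial_def mult_single plus_word_def)

lemma path_to_arcs: "path_to s p \<Longrightarrow> set p \<subseteq> arcs G"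
  by (induction p) auto

lemma path_monomial_homogeneous:
  assumes "s \<in> verts G" "path_to s p"
  shows "path_monomial s p \<in> homogeneous (int (length p))"
proof -
  have "sum_list (map letter_degree (map Edge p :: ('a, 'b) letter list)) = int (length p)" by (induction p) auto
  then show ?thesis
    using path_to_arcs[OF assms(2)] assms(1)
    by (auto simp: path_monomial_def nonunital_part_iff word_degree_def)
qed

lemma path_monomial_carrier:
  "s \<in> verts G \<Longrightarrow> path_to s p \<Longrightarrow> path_monomial s p \<in> carrier (free_algebra G)"
  using path_monomial_homogeneous by (blast intro: nonunital_in_carrier)

abbreviation point :: "'b list \<Rightarrow> 'b list \<Rightarrow> 'k::field"
  where "point p \<equiv> \<lambda>q. if q = p then 1 else 0"

lemma path_monomial_action:
  assumes "path_to s p"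
  shows "poly_action s (path_monomial s p) (point []) = point p"
proof -
  have "foldr (letter_action s) (map Edge p @ [Vertex s]) (point []) = point p"
    using assms
  proof (induction p)
    case Nil
    then show ?case by (auto simp: fun_eq_iff)
  next
    case (Cons e p)
    then show ?case by (auto simp: fun_eq_iff split: list.splits)
  qed
  then show ?thesis by (simp add: fun_eq_iff path_monomial_def poly_action_single word_action_def)
qed

lemma leavitt_ideal_cong_trans:
  "x - y \<in> leavitt_ideal G \<Longrightarrow> y - z \<in> leavitt_ideal G \<Longrightarrow> x - z \<in> leavitt_ideal G"
  using leavitt_ideal_add[of "x - y" "y - z"] by simp

text \<open>
  A nontrivial path starts with an edge \<open>e\<close>, in front of which its tail can be inserted, so that
  the claim reduces to the orthogonality of the vertices.
\<close>

lemma vertex_mult_path: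
  assumes "s \<in> verts G" "path_to s p" "u \<in> verts G"
  shows "vtx u * path_monomial s p - (if u = path_start s p then path_monomial s p else 0) \<in> leavitt_ideal G"
proof (cases p)
  case Nil
  then show ?thesis using vertex_relation[of u s] assms by (auto simp: path_monomial_Nil)
next
  case (Cons e q)
  let ?v = "vtx (tail G e)" and ?P = "path_monomial s q"
  have e: "e \<in> arcs G" and q: "path_to s q" using assms Cons by auto
  have closed: "vtx u \<in> carrier (free_algebra G)" "edge e * ?P \<in> carrier (free_algebra G)"
      "?P \<in> carrier (free_algebra G)"
    using letter_in_free_algebra[of "Vertex u"] assms(3) path_monomial_carrier[OF assms(1,2)]
      path_monomial_carrier[OF assms(1) q] by (simp_all add: Cons path_monomial_Cons)
  have te: "(?v * edge e - edge e) * ?P \<in> leavitt_ideal G"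
    by (intro leavitt_ideal_mult_right tail_edge_relation e closed)
  have uv: "(vtx u * ?v - (if u = tail G e then ?v else 0)) * (edge e * ?P) \<in> leavitt_ideal G"
    using assms e by (intro leavitt_ideal_mult_right vertex_relation closed) auto
  let ?x = "(?v * edge e - edge e) * ?P"
  have eq: "vtx u * path_monomial s p - (if u = path_start s p then path_monomial s p else 0) =
      (vtx u * ?v - (if u = tail G e then ?v else 0)) * (edge e * ?P)
        - vtx u * ?x + (if u = tail G e then ?x else 0)"
    by (simp add: Cons path_monomial_Cons algebra_simps)
  have "(if u = tail G e then ?x else 0) \<in> leavitt_ideal G"
    by (rule if_split[THEN iffD2]) (intro conjI impI te leavitt_ideal_zero)
  then show ?thesis
    unfolding eq by (intro leavitt_ideal_add leavitt_ideal_diff leavitt_ideal_mult_left uv te closed(1))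
qed

lemma vertex_mult_path_start:
  assumes "s \<in> verts G" "path_to s p"
  shows "vtx (path_start s p) * path_monomial s p - path_monomial s p \<in> leavitt_ideal G"
  using vertex_mult_path[OF assms path_start_in_verts[OF assms]] by simp

lemma vertex_mult_path_other:
  assumes "s \<in> verts G" "path_to s p" "u \<in> verts G" "u \<noteq> path_start s p"
  shows "vtx u * path_monomial s p \<in> leavitt_ideal G"
  using vertex_mult_path[OF assms(1-3)] assms(4) by simp

text \<open>
  If \<open>x\<close> ends at \<open>u\<close> and the path starts elsewhere, then \<open>x p = x u p = 0\<close>.
\<close>

lemma mult_path_zero:
  fixes x :: "('a, 'b, 'k::field) path_poly"
  assumes "x * vtx u - x \<in> leavitt_ideal G" "x \<in> carrier (free_algebra G)"
    and "s \<in> verts G" "path_to s p" "u \<in> verts G" "u \<noteq> path_start s p"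
  shows "x * path_monomial s p \<in> leavitt_ideal G"
proof -
  have eq: "x * path_monomial s p = x * (vtx u * path_monomial s p) - (x * vtx u - x) * path_monomial s p"
    by (simp add: algebra_simps)
  have "x * (vtx u * path_monomial s p) \<in> leavitt_ideal G"
    using assms by (intro leavitt_ideal_mult_left vertex_mult_path_other)
  moreover have "(x * vtx u - x) * path_monomial s p \<in> leavitt_ideal G"
    using assms by (intro leavitt_ideal_mult_right path_monomial_carrier)
  ultimately show ?thesis unfolding eq by (rule leavitt_ideal_diff)
qed

text \<open>
  Multiplication by a letter turns a path into a path or into zero, and the representation does the
  same to indicator functions. That no edge leaves \<open>s\<close> matters for a ghost edge \<open>e\<close> applied to the
  trivial path: \<open>e\<^sup>* s = e\<^sup>* (tail e) s = 0\<close>, because \<open>s\<close> is not the tail of \<open>e\<close>.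
\<close>

lemma letter_mult_path:
  fixes l :: "('a, 'b) letter"
  assumes s: "sink G s" and p: "path_to s p" and l: "l \<in> graph_letters G"
  defines "x \<equiv> Poly_Mapping.single (Word [l]) (1 :: 'k::field)"
  shows "(x * path_monomial s p \<in> leavitt_ideal G \<and> letter_action s l (point p) = (\<lambda>_. 0 :: 'k)) \<or>
    (\<exists>q. path_to s q \<and> int (length q) = letter_degree l + int (length p) \<and>
      x * path_monomial s p - path_monomial s q \<in> leavitt_ideal G \<and> letter_action s l (point p) = (point q :: _ \<Rightarrow> 'k))"
proof -
  have sv: "s \<in> verts G" using s by (simp add: sink_def)
  have x: "x \<in> carrier (free_algebra G)" unfolding x_def using l by (rule letter_in_free_algebra)
  show ?thesis
  proof (cases l)
    case (Vertex u)
    then have xu: "x = vtx u" and u: "u \<in> verts G" using l by (simp_all add: x_def)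
    show ?thesis
    proof (cases "u = path_start s p")
      case True
      then have "letter_action s l (point p) = (point p :: _ \<Rightarrow> 'k)"
        using p by (auto simp: Vertex fun_eq_iff)
      then show ?thesis using vertex_mult_path_start[OF sv p] p True
        by (intro disjI2 exI[of _ p]) (simp add: xu Vertex)
    next
      case False
      then show ?thesis using vertex_mult_path_other[OF sv p u] by (auto simp: xu Vertex fun_eq_iff)
    qed
  next
    case (Edge e)
    then have xe: "x = edge e" and e: "e \<in> arcs G" using l by (simp_all add: x_def)
    show ?thesis
    proof (cases "head G e = path_start s p")
      case True
      then have "letter_action s l (point p) = (point (e # p) :: _ \<Rightarrow> 'k)"
        using p e by (auto simp: Edge fun_eq_iff split: list.splits)
      then show ?thesis using p e True
        by (intro disjI2 exI[of _ "e # p"]) (simp add: xe Edge path_monomial_Cons leavitt_ideal_zero)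
    next
      case False
      have "x * path_monomial s p \<in> leavitt_ideal G"
        using e edge_head_relation[OF e] False
        by (intro mult_path_zero[OF _ x sv p, of "head G e"]) (simp_all add: xe)
      then show ?thesis using False by (auto simp: Edge fun_eq_iff split: list.splits)
    qed
  next
    case (Ghost e)
    then have xe: "x = ghost e" and e: "e \<in> arcs G" using l by (simp_all add: x_def)
    show ?thesis
    proof (cases p)
      case Nil
      have "x * path_monomial s p \<in> leavitt_ideal G"
        using e ghost_tail_relation[OF e] sink_not_tail[OF s e] Nil
        by (intro mult_path_zero[OF _ x sv p, of "tail G e"]) (simp_all add: xe)
      then show ?thesis by (auto simp: Ghost Nil fun_eq_iff)
    next
      case (Cons f q)
      have f: "f \<in> arcs G" and hf: "head G f = path_start s q" and q: "path_to s q" using p by (simp_all add: Cons)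
      have red: "x * path_monomial s p - (if e = f then vtx (head G e) else 0) * path_monomial s q \<in> leavitt_ideal G"
        using leavitt_ideal_mult_right[OF ghost_edge_relation[OF e f] path_monomial_carrier[OF sv q]]
        by (simp add: xe Cons path_monomial_Cons left_diff_distrib mult.assoc)
      show ?thesis
      proof (cases "e = f")
        case True
        then have "x * path_monomial s p - path_monomial s q \<in> leavitt_ideal G"
          using red vertex_mult_path_start[OF sv q] hf by (intro leavitt_ideal_cong_trans[OF red]) simp
        moreover have "letter_action s l (point p) = (point q :: _ \<Rightarrow> 'k)"
          using True f hf q by (auto simp: Ghost Cons fun_eq_iff)
        ultimately show ?thesis using q by (intro disjI2 exI[of _ q]) (simp add: Ghost Cons)
      next
        case False
        then show ?thesis using red by (auto simp: Ghost Cons fun_eq_iff)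
      qed
    qed
  qed
qed

lemma word_mult_sink:
  fixes ls :: "('a, 'b) letter list"
  assumes s: "sink G s" and ls: "set ls \<subseteq> graph_letters G"
  defines "x \<equiv> Poly_Mapping.single (Word ls) (1 :: 'k::field)"
  shows "(x * vtx s \<in> leavitt_ideal G \<and> word_action s (Word ls) (point []) = (\<lambda>_. 0 :: 'k)) \<or>
    (\<exists>q. path_to s q \<and> int (length q) = word_degree (Word ls) \<and>
      x * vtx s - path_monomial s q \<in> leavitt_ideal G \<and> word_action s (Word ls) (point []) = (point q :: _ \<Rightarrow> 'k))"
  using ls unfolding x_def
proof (induction ls)
  case Nil
  have one: "Poly_Mapping.single (Word []) (1 :: 'k) = (1 :: ('a, 'b, 'k) path_poly)"
    by (simp flip: zero_word_def)
  show ?case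
    by (intro disjI2 exI[of _ "[]"]) (simp add: one path_monomial_Nil leavitt_ideal_zero word_action_def word_degree_def)
next
  case (Cons l ls)
  let ?l = "Poly_Mapping.single (Word [l]) (1 :: 'k)" and ?w = "Poly_Mapping.single (Word ls) (1 :: 'k)"
  have split: "Poly_Mapping.single (Word (l # ls)) (1 :: 'k) * vtx s = ?l * (?w * vtx s)"
    by (simp add: mult_single plus_word_def)
  have l: "l \<in> graph_letters G" "?l \<in> carrier (free_algebra G)"
    using Cons.prems letter_in_free_algebra by auto
  have act: "word_action s (Word (l # ls)) f = letter_action s l (word_action s (Word ls) f)" for f :: "_ \<Rightarrow> 'k"
    by (simp add: word_action_def)
  have zero: "letter_action s l (\<lambda>_. 0) = (\<lambda>_. 0 :: 'k)"
    by (cases l) (auto simp: fun_eq_iff split: list.splits)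
  have deg: "word_degree (Word (l # ls)) = letter_degree l + word_degree (Word ls)"
    by (simp add: word_degree_def)
  have "set ls \<subseteq> graph_letters G" using Cons.prems by simp
  from Cons.IH[OF this] show ?case
  proof (elim disjE exE conjE)
    assume "?w * vtx s \<in> leavitt_ideal G" "word_action s (Word ls) (point []) = (\<lambda>_. 0 :: 'k)"
    then show ?thesis unfolding split act using l zero by (simp add: leavitt_ideal_mult_left)
  next
    fix q
    assume q: "path_to s q" "int (length q) = word_degree (Word ls)"
      "?w * vtx s - path_monomial s q \<in> leavitt_ideal G" "word_action s (Word ls) (point []) = (point q :: _ \<Rightarrow> 'k)"
    have *: "?l * (?w * vtx s) - ?l * path_monomial s q \<in> leavitt_ideal G"
      using leavitt_ideal_mult_left[OF q(3) l(2)] by (simp add: right_diff_distrib)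
    have **: "?l * (?w * vtx s) \<in> leavitt_ideal G" if "?l * path_monomial s q \<in> leavitt_ideal G"
      using leavitt_ideal_add[OF * that] by simp
    show ?thesis
      using letter_mult_path[OF s q(1) l(1), where 'k = 'k] leavitt_ideal_cong_trans[OF *] **
      unfolding split act deg q(4) q(2)[symmetric] by blast
  qed
qed

definition paths_of_degree :: "'a \<Rightarrow> int \<Rightarrow> 'b list set"
  where "paths_of_degree s d = {p. path_to s p \<and> int (length p) = d}"

lemma finite_paths_of_degree: "finite (paths_of_degree s d)"
proof (rule finite_subset)
  show "paths_of_degree s d \<subseteq> {p. set p \<subseteq> arcs G \<and> length p = nat d}"
    using path_to_arcs by (auto simp: paths_of_degree_def)
  show "finite {p. set p \<subseteq> arcs G \<and> length p = nat d}"
    by (rule finite_lists_length_eq) simp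
qed

text \<open>
  Thus the paths of length \<open>d\<close> into \<open>s\<close> span the component of degree \<open>d\<close> of \<open>R s\<close>. The coefficients
  are read off from the representation, so an element that maps the indicator function of the trivial
  path to zero is annihilated by \<open>s\<close>.
\<close>

lemma homogeneous_mult_sink:
  fixes x :: "('a, 'b, 'k::field) path_poly"
  assumes s: "sink G s" and x: "x \<in> homogeneous d"
  shows "x * vtx s - (\<Sum>p\<in>paths_of_degree s d. Poly_Mapping.single 0 (poly_action s x (point []) p) * path_monomial s p)
    \<in> leavitt_ideal G"
proof (rule poly_mapping_span_induct[where p = x])
  fix w
  assume w: "w \<in> Poly_Mapping.keys x"
  define c where "c = Poly_Mapping.lookup x w"
  have letters: "set (letters w) \<subseteq> graph_letters G" and deg: "word_degree w = d"
    using w x by (auto simp: nonunital_part_iff)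
  have const: "Poly_Mapping.single 0 c \<in> carrier (free_algebra G)"
    by (simp add: free_algebra_carrier_iff)
  have split: "Poly_Mapping.single w c * vtx s = Poly_Mapping.single 0 c * (Poly_Mapping.single w 1 * vtx s)"
    by (simp add: mult_single)
  show "Poly_Mapping.single w c * vtx s - (\<Sum>p\<in>paths_of_degree s d.
      Poly_Mapping.single 0 (poly_action s (Poly_Mapping.single w c) (point []) p) * path_monomial s p) \<in> leavitt_ideal G"
    using word_mult_sink[OF s letters, where 'k = 'k, unfolded word.collapse]
  proof (elim disjE exE conjE)
    assume *: "Poly_Mapping.single w (1 :: 'k) * vtx s \<in> leavitt_ideal G" "word_action s w (point []) = (\<lambda>_. 0 :: 'k)"
    have "Poly_Mapping.single 0 c * (Poly_Mapping.single w 1 * vtx s) \<in> leavitt_ideal G"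
      using * const by (simp add: leavitt_ideal_mult_left)
    then show ?thesis using *(2) by (simp add: poly_action_single split)
  next
    fix q
    assume q: "path_to s q" "int (length q) = word_degree w"
      "Poly_Mapping.single w (1 :: 'k) * vtx s - path_monomial s q \<in> leavitt_ideal G"
      "word_action s w (point []) = (point q :: _ \<Rightarrow> 'k)"
    have "q \<in> paths_of_degree s d" using q deg by (simp add: paths_of_degree_def)
    then have "(\<Sum>p\<in>paths_of_degree s d.
        Poly_Mapping.single 0 (poly_action s (Poly_Mapping.single w c) (point []) p) * path_monomial s p) =
        Poly_Mapping.single 0 c * path_monomial s q"
      using finite_paths_of_degree by (simp add: poly_action_single q(4) if_distrib if_distribR cong: if_cong)
    then show ?thesis
      using leavitt_ideal_mult_left[OF q(3) const] by (simp add: split right_diff_distrib)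
  qed
next
  fix y z :: "('a, 'b, 'k) path_poly"
  assume "y * vtx s - (\<Sum>p\<in>paths_of_degree s d. Poly_Mapping.single 0 (poly_action s y (point []) p) * path_monomial s p)
    \<in> leavitt_ideal G"
    "z * vtx s - (\<Sum>p\<in>paths_of_degree s d. Poly_Mapping.single 0 (poly_action s z (point []) p) * path_monomial s p)
    \<in> leavitt_ideal G"
  from leavitt_ideal_add[OF this]
  show "(y + z) * vtx s -
      (\<Sum>p\<in>paths_of_degree s d. Poly_Mapping.single 0 (poly_action s (y + z) (point []) p) * path_monomial s p)
    \<in> leavitt_ideal G"
    by (simp add: poly_action_add single_add distrib_right sum.distrib add_diff_add)
qed (simp add: poly_action_zero leavitt_ideal_zero)

end

section \<open>Invariant basis number\<close>

context fin_digraph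
begin

text \<open>
  The value does not depend on the chosen representative, as the ideal acts trivially.
\<close>

definition coordinate :: "'a \<Rightarrow> ('a, 'b, 'k::field) path_poly set \<Rightarrow> 'b list \<Rightarrow> 'k"
  where "coordinate s X = poly_action s (SOME x. x \<in> nonunital_part G \<and> X = leavitt_class G x) (point [])"

lemma coordinate_class:
  fixes x :: "('a, 'b, 'k::field) path_poly"
  assumes s: "sink G s" and x: "x \<in> nonunital_part G"
  shows "coordinate s (leavitt_class G x) p = poly_action s x (point []) p"
proof -
  define y where "y = (SOME y. y \<in> nonunital_part G \<and> leavitt_class G x = leavitt_class G y)"
  have y: "y \<in> nonunital_part G \<and> leavitt_class G x = leavitt_class G y"
    unfolding y_def by (rule someI[of _ x]) (simp add: x)
  then have "x - y \<in> leavitt_ideal G"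
    using x leavitt_class_eq_iff[of x y] by (simp add: nonunital_in_carrier)
  from leavitt_ideal_acts_trivially[OF s this, of "point []" p]
  show ?thesis by (simp add: coordinate_def poly_action_diff flip: y_def)
qed

lemma graded_ring_with_coordinates_sink:
  assumes s: "sink G s"
  shows "graded_ring_with_coordinates
    (leavitt_path_algebra G :: ('a, 'b, 'k::field) path_poly set ring) (leavitt_grading G)
    (paths_of_degree s) (\<lambda>p. leavitt_class G (path_monomial s p)) (coordinate s)
    (\<lambda>c. leavitt_class G (Poly_Mapping.single (Word [Vertex s]) c))"
proof (rule graded_ring_with_coordinates.intro[OF graded_ring_leavitt graded_ring_with_coordinates_axioms.intro])
  let ?L = "leavitt_path_algebra G :: ('a, 'b, 'k::field) path_poly set ring"
  let ?u = "\<lambda>c :: 'k. Poly_Mapping.single (Word [Vertex s]) c :: ('a, 'b, 'k) path_poly"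
  have sv: "s \<in> verts G" using s by (simp add: sink_def)
  have u: "?u c \<in> homogeneous 0" for c
    using sv by (auto simp: nonunital_single word_degree_def)
  fix p q :: "'b list" and \<delta> :: int and c :: 'k and X Y :: "('a, 'b, 'k) path_poly set"
  show "finite (paths_of_degree s \<delta>)" by (rule finite_paths_of_degree)
  show "leavitt_class G (path_monomial s p) \<in> (leavitt_grading G \<delta> :: ('a, 'b, 'k) path_poly set set)"
    if p: "p \<in> paths_of_degree s \<delta>"
  proof -
    have "path_monomial s p \<in> (homogeneous \<delta> :: ('a, 'b, 'k) path_poly set)"
      using path_monomial_homogeneous[OF sv, of p] p by (auto simp: paths_of_degree_def)
    then show ?thesis unfolding leavitt_grading_def by blast
  qed
  show "leavitt_class G (?u c) \<in> leavitt_grading G 0"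
    unfolding leavitt_grading_def using u by blast
  show "coordinate s (X \<oplus>\<^bsub>?L\<^esub> Y) p = coordinate s X p + coordinate s Y p"
    if X: "X \<in> carrier ?L" and Y: "Y \<in> carrier ?L"
  proof -
    obtain x where x: "X = leavitt_class G x" "x \<in> nonunital_part G" using X by (auto simp: leavitt_carrier)
    obtain y where y: "Y = leavitt_class G y" "y \<in> nonunital_part G" using Y by (auto simp: leavitt_carrier)
    show ?thesis using x y by (simp add: leavitt_add coordinate_class[OF s] nonunital_add poly_action_add)
  qed
  show "coordinate s (X \<otimes>\<^bsub>?L\<^esub> leavitt_class G (?u c)) p = coordinate s X p * c"
    if X: "X \<in> carrier ?L"
  proof -
    obtain x where x: "X = leavitt_class G x" "x \<in> nonunital_part G" using X by (auto simp: leavitt_carrier)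
    have uN: "?u c \<in> nonunital_part G" using u by blast
    have "poly_action s (?u c) (point []) = (\<lambda>p. c * point [] p)"
      by (auto simp: fun_eq_iff poly_action_single word_action_def)
    then show ?thesis
      using x uN by (simp only: leavitt_mult coordinate_class[OF s] nonunital_mult poly_action_mult
          poly_action_scale mult.commute)
  qed
  show "coordinate s (leavitt_class G (path_monomial s p)) q = (if p = q then 1 else 0 :: 'k)"
    if p: "p \<in> paths_of_degree s \<delta>"
  proof -
    have "path_to s p" using p by (simp add: paths_of_degree_def)
    moreover from this have "path_monomial s p \<in> (nonunital_part G :: ('a, 'b, 'k) path_poly set)"
      using path_monomial_homogeneous[OF sv] by blast
    ultimately show ?thesis by (auto simp: coordinate_class[OF s] path_monomial_action)
  qed
  show "X \<otimes>\<^bsub>?L\<^esub> leavitt_class G (?u 1) = \<zero>\<^bsub>?L\<^esub>"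
    if X: "X \<in> leavitt_grading G \<delta>" and zero: "\<And>p. p \<in> paths_of_degree s \<delta> \<Longrightarrow> coordinate s X p = 0"
  proof -
    obtain x where x: "X = leavitt_class G x" "x \<in> homogeneous \<delta>" using X by (auto simp: leavitt_grading_def)
    have xN: "x \<in> nonunital_part G" and uN: "?u 1 \<in> nonunital_part G" using x(2) u by blast+
    have "poly_action s x (point []) p = 0" if "p \<in> paths_of_degree s \<delta>" for p
      using zero[OF that] xN by (simp add: x(1) coordinate_class[OF s])
    then have "x * ?u 1 \<in> leavitt_ideal G"
      using homogeneous_mult_sink[OF s x(2)] by simp
    moreover have "x * ?u 1 \<in> nonunital_part G" using xN uN by (rule nonunital_mult)
    ultimately have "leavitt_class G (x * ?u 1) = leavitt_class G 0"
      by (subst leavitt_class_eq_iff) (simp_all add: nonunital_in_carrier nonunital_zero)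
    then show ?thesis using xN uN by (simp only: x(1) leavitt_mult leavitt_zero)
  qed
qed

end

theorem proposition3p2:
  fixes E :: "('v, 'e) pre_digraph"
  assumes "fin_digraph E"
    and "\<exists>v. sink E v"
  shows "gr_IBN (leavitt_path_algebra E :: ('v, 'e, 'k::field) path_poly set ring)
                (leavitt_grading E)"
proof -
  interpret fin_digraph E by (rule assms(1))
  obtain s where s: "sink E s" using assms(2) by blast
  let ?L = "leavitt_path_algebra E :: ('v, 'e, 'k) path_poly set ring"
  interpret L: graded_ring_with_coordinates ?L "leavitt_grading E" "paths_of_degree s"
      "\<lambda>p. leavitt_class E (path_monomial s p)" "coordinate s"
      "\<lambda>c. leavitt_class E (Poly_Mapping.single (Word [Vertex s]) c)"
    by (rule graded_ring_with_coordinates_sink[OF s])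
  let ?a = "\<lambda>d. card (paths_of_degree s d)"
  have neg: "?a d = 0" if "d < 0" for d
    using that by (simp add: paths_of_degree_def)
  have "[] \<in> paths_of_degree s 0" by (simp add: paths_of_degree_def)
  then have pos: "?a 0 > 0" using finite_paths_of_degree card_gt_0_iff by blast
  show ?thesis
    unfolding gr_IBN_def
  proof (intro conjI allI impI)
    show "graded_ring ?L (leavitt_grading E)" by (rule graded_ring_leavitt)
  next
    fix m n and \<alpha> \<beta> :: "nat \<Rightarrow> int"
    assume iso: "graded_iso ?L (shifted_free ?L (leavitt_grading E) m \<alpha>) (shifted_free ?L (leavitt_grading E) n \<beta>)"
    have shift_sum: "(\<Sum>x\<in>#image_mset \<delta> (mset_set {..<k}). ?a (x + \<gamma>)) = (\<Sum>i<k. ?a (\<delta> i + \<gamma>))"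
      for \<delta> :: "nat \<Rightarrow> int" and k \<gamma>
      by (induction k) (simp_all add: lessThan_Suc)
    have "(\<Sum>x\<in>#image_mset \<alpha> (mset_set {..<m}). ?a (x + \<gamma>)) =
        (\<Sum>x\<in>#image_mset \<beta> (mset_set {..<n}). ?a (x + \<gamma>))" for \<gamma>
      unfolding shift_sum by (rule L.sum_card_basis_eq[OF iso])
    then have "image_mset \<alpha> (mset_set {..<m}) = image_mset \<beta> (mset_set {..<n})"
      by (rule multiset_eq_if_shifted_sums_eq[where a = ?a, rotated 2]) (fact neg pos)+
    then have "size (image_mset \<alpha> (mset_set {..<m})) = size (image_mset \<beta> (mset_set {..<n}))"
      by (rule arg_cong)
    then show "m = n" by simp
  qed
qed

end
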